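(* Let $G$ be a finitely generated group with a finite generating set $A$, and let $\psi : L \rightarrow G$ be a Cayley p.f. linear-time computable representation of $G$. There is an algorithm which for a given input word $v \in (A\cup A^{-1})^*$ computes the string $u\in L$ for which $\psi(u)=\pi(v)$ in $G$. Moreover, this algorithm can be implemented by a deterministic position-faithful one-tape Turing machine in quadratic time (in the length of $v$).
   Context: Position-faithful one-tape Turing machine: a Turing machine with one semi-infinite tape (infinite in one direction only) whose left-most cell contains a special symbol $\boxplus$ which occurs only there and cannot be modified. On input $x$ (a string over a finite alphabet not containing $\boxplus,\boxdot$) the initial tape content is $\boxplus x\boxdot^\infty$, where $\boxdot$ is a special blank symbol, and the head starts at $\boxplus$. The machine computes a function $f$ if on every input $x$ it eventually reaches an accepting state and halts with the tape having prefix $\boxplus f(x)\boxdot$ (no restriction on the tape content after this first $\boxdot$). A function $f:\Sigma^*\to\Sigma^*$ is position-faithful (p.f.) linear-time computable if it is computed by a deterministic position-faithful one-tape Turing machine in time linear in the input length. Let $G$ be a finitely generated group and $S=\{s_1,\dots,s_n\}\subset G$ a finite set of semigroup generators (every $g\in G$ is a product of elements of $S$). A Cayley p.f. linear-time computable representation of $G$ is a bijection $\psi:L\to G$, where $L\subseteq\Sigma^*$ is a language over a finite alphabet $\Sigma$, for which there exist p.f. linear-time computable functions $f_i:\Sigma^*\to\Sigma^*$, $i=1,\dots,n$, with $f_i(L)\subseteq L$ and $\psi(f_i(w))=\psi(w)s_i$ for all $w\in L$. Here $S=A\cup A^{-1}$, where $A$ is a finite generating set of $G$. For a word $v=s_1\dots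 s_m\in(A\cup A^{-1})^*$, $\pi(v)\in G$ denotes the product $s_1\cdots s_m$ in $G$ (the identity if $v$ is empty). *)

theory Defs
  imports "HOL-Algebra.Generated_Groups" "HOL-Library.Landau_Symbols"
begin

text \<open>
  The tape alphabet is a finite set of symbols that may contain, besides the left-end marker,
  the blank and the letters of input and output, further working symbols; these, like the
  states, are numbered by naturals.
\<close>

datatype 'a cell = Marker | Blank | Letter 'a | Work nat

datatype move = MoveLeft | MoveRight | Stay

record 'a machine =
  states :: "nat set"
  alphabet :: "'a cell set"
  start :: nat
  accepting :: "nat set"
  delta :: "nat \<Rightarrow> 'a cell \<Rightarrow> nat \<times> 'a cell \<times> move"

text \<open>
  The conditions on \<open>delta\<close> say that the marker is never overwritten, never written
  anywhere else, and never passed to the left.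
\<close>

definition pf_machine :: "'a set \<Rightarrow> 'a machine \<Rightarrow> bool" where
  "pf_machine X M \<longleftrightarrow>
     finite (states M) \<and> finite (alphabet M) \<and>
     start M \<in> states M \<and> accepting M \<subseteq> states M \<and>
     insert Marker (insert Blank (Letter ` X)) \<subseteq> alphabet M \<and>
     (\<forall>q\<in>states M. \<forall>a\<in>alphabet M. \<forall>q' b d. delta M q a = (q', b, d) \<longrightarrow>
        q' \<in> states M \<and> b \<in> alphabet M \<and>
        (b = Marker \<longleftrightarrow> a = Marker) \<and> (a = Marker \<longrightarrow> d \<noteq> MoveLeft))"

text \<open>A configuration consists of the state, the head position and the tape content.\<close>

type_synonym 'a config = "nat \<times> nat \<times> (nat \<Rightarrow> 'a cell)"

fun move_head :: "move \<Rightarrow> nat \<Rightarrow> nat" where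
  "move_head MoveLeft h = h - 1"
| "move_head MoveRight h = h + 1"
| "move_head Stay h = h"

text \<open>The machine halts as soon as it is in an accepting state.\<close>

fun step :: "'a machine \<Rightarrow> 'a config \<Rightarrow> 'a config" where
  "step M (q, h, tp) =
     (if q \<in> accepting M then (q, h, tp)
      else case delta M q (tp h) of (q', b, d) \<Rightarrow> (q', move_head d h, tp(h := b)))"

definition initial_tape :: "'a list \<Rightarrow> nat \<Rightarrow> 'a cell" where
  "initial_tape x i =
     (if i = 0 then Marker else if i \<le> length x then Letter (x ! (i - 1)) else Blank)"

definition initial_config :: "'a machine \<Rightarrow> 'a list \<Rightarrow> 'a config" where
  "initial_config M x = (start M, 0, initial_tape x)"

definition tape_output :: "(nat \<Rightarrow> 'a cell) \<Rightarrow> 'a list \<Rightarrow> bool" where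
  "tape_output tp y \<longleftrightarrow> map tp [0..<length y + 2] = Marker # map Letter y @ [Blank]"

definition outputs_within :: "'a machine \<Rightarrow> 'a list \<Rightarrow> 'a list \<Rightarrow> nat \<Rightarrow> bool" where
  "outputs_within M x y t \<longleftrightarrow>
     (\<exists>k\<le>t. \<exists>q h tp. (step M ^^ k) (initial_config M x) = (q, h, tp) \<and>
        q \<in> accepting M \<and> tape_output tp y)"

text \<open>
  \<open>f\<close> maps words over \<open>X\<close> to words over \<open>Y\<close> and is computed in time \<open>O(B)\<close>. The maps
  \<open>i\<close> and \<open>j\<close> embed the input and output letters into the common type of letters on the tape;
  they are needed when \<open>X\<close> and \<open>Y\<close> are different alphabets.
\<close>

definition pf_computable_in ::
  "('a \<Rightarrow> 'c) \<Rightarrow> 'a set \<Rightarrow> ('b \<Rightarrow> 'c) \<Rightarrow> 'b set \<Rightarrow> ('a list \<Rightarrow> 'b list) \<Rightarrow> (nat \<Rightarrow> real) \<Rightarrow> bool" where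
  "pf_computable_in i X j Y f B \<longleftrightarrow>
     f \<in> lists X \<rightarrow> lists Y \<and>
     (\<exists>M T. pf_machine (i ` X) M \<and> (\<lambda>n. real (T n)) \<in> O(B) \<and>
        (\<forall>x\<in>lists X. outputs_within M (map i x) (map j (f x)) (T (length x))))"

definition pf_linear_computable :: "'a set \<Rightarrow> ('a list \<Rightarrow> 'a list) \<Rightarrow> bool" where
  "pf_linear_computable \<Sigma> f \<longleftrightarrow> pf_computable_in id \<Sigma> id \<Sigma> f (\<lambda>n. real n)"

definition word_prod :: "('g, 'm) monoid_scheme \<Rightarrow> 'g list \<Rightarrow> 'g" where
  "word_prod G v = foldr (\<lambda>x y. x \<otimes>\<^bsub>G\<^esub> y) v \<one>\<^bsub>G\<^esub>"

definition semigroup_generators :: "('g, 'm) monoid_scheme \<Rightarrow> 'g set \<Rightarrow> bool" where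
  "semigroup_generators G S \<longleftrightarrow>
     finite S \<and> S \<subseteq> carrier G \<and> (\<forall>g\<in>carrier G. \<exists>v\<in>lists S. word_prod G v = g)"

definition cayley_pf_linear_rep ::
  "('g, 'm) monoid_scheme \<Rightarrow> 'g set \<Rightarrow> 's set \<Rightarrow> 's list set \<Rightarrow> ('s list \<Rightarrow> 'g) \<Rightarrow> bool" where
  "cayley_pf_linear_rep G S \<Sigma> L \<psi> \<longleftrightarrow>
     semigroup_generators G S \<and> finite \<Sigma> \<and> L \<subseteq> lists \<Sigma> \<and> bij_betw \<psi> L (carrier G) \<and>
     (\<exists>f. \<forall>s\<in>S. pf_linear_computable \<Sigma> (f s) \<and> f s ` L \<subseteq> L \<and>
        (\<forall>w\<in>L. \<psi> (f s w) = \<psi> w \<otimes>\<^bsub>G\<^esub> s))"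

end

theory Submission
  imports Defs
begin

text \<open>
  Let \<open>w0\<close> be the word in \<open>L\<close> that represents the identity. For \<open>v = s1 \<dots> sm\<close> the word
  \<open>u v = f sm (\<dots> (f s1 w0))\<close> lies in \<open>L\<close> and represents \<open>s1 \<dots> sm\<close>, so the algorithm is to
  run the machines for \<open>f s1\<close>, \<dots>, \<open>f sm\<close> one after the other. What has to be shown is that
  the total time is quadratic. A function computed in linear time could a priori multiply the
  length of a word by a constant, and then \<open>m\<close> rounds would give exponentially long words.

  The main point is that on a one-tape machine this cannot happen: in linear time the head
  moves at most a constant number of cells beyond the end of the input
  (\<open>linear_time_head_bound\<close>). On a long input two boundaries between cells have the same
  crossing sequence, and the part of the input between them can be cut out without changing
  what happens to the right of it (\<open>cut_between_equal_crossings\<close>). So the head excess on any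
  input also occurs on one of finitely many short inputs.

  Hence after each of the \<open>m\<close> rounds the used part of the tape has grown by at most a constant,
  its length is \<open>O(m)\<close> throughout, and each round takes time \<open>O(m)\<close>. The locale \<open>iteration\<close>
  contains a machine that does this on a tape with two tracks. In each round it walks over the
  used part of the tape to erase the garbage that the previous simulation left behind the first
  blank and to consume the next input letter; then it returns to the marker and is ready for the
  next simulation (\<open>reach_rounds\<close>). \<open>realize_machine\<close> turns it into a machine with numbered
  states and symbols, and \<open>iterate_computable\<close> is the resulting complexity bound for the
  iteration of any finite family of linear-time functions.
\<close>

section \<open>Runs and head movement\<close>

abbreviation head :: "'a config \<Rightarrow> nat" where
  "head c \<equiv> fst (snd c)"

abbreviation tape :: "'a config \<Rightarrow> nat \<Rightarrow> 'a cell" where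
  "tape c \<equiv> snd (snd c)"

lemma head_step: "head (step M c) \<le> head c + 1" "head c \<le> head (step M c) + 1"
proof -
  have "move_head d h \<le> h + 1 \<and> h \<le> move_head d h + 1" for d h
    by (cases d) auto
  then show "head (step M c) \<le> head c + 1" "head c \<le> head (step M c) + 1"
    by (cases c; auto split: prod.splits)+
qed

lemma tape_step: "i \<noteq> head c \<Longrightarrow> tape (step M c) i = tape c i"
  by (cases c) (auto split: prod.splits)

text \<open>
  A step depends only on the state and the scanned cell, so it commutes with translating the
  tape. A positive translation needs the head away from cell \<open>0\<close>, because there
  \<^const>\<open>move_head\<close> truncates a move to the left.
\<close>

lemma step_eq_shifted:
  assumes "tp h = tp2 h2" and "h2 = h + d" and "d = 0 \<or> 0 < h"
  shows "fst (step M (q, h, tp)) = fst (step M (q, h2, tp2))"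
    and "head (step M (q, h, tp)) + d = head (step M (q, h2, tp2))"
    and "tape (step M (q, h, tp)) h = tape (step M (q, h2, tp2)) h2"
proof -
  have "move_head m h + d = move_head m h2" for m
    using assms(2,3) by (cases m) auto
  then show "fst (step M (q, h, tp)) = fst (step M (q, h2, tp2))"
    and "head (step M (q, h, tp)) + d = head (step M (q, h2, tp2))"
    and "tape (step M (q, h, tp)) h = tape (step M (q, h2, tp2)) h2"
    using assms by (auto split: prod.splits)
qed

lemma head_steps: "head ((step M ^^ t) c) \<le> head c + t"
proof (induction t)
  case (Suc t)
  then show ?case using head_step(1)[of M "(step M ^^ t) c"] by simp
qed simp

section \<open>Crossing sequences\<close>

text \<open>
  Boundary \<open>b\<close> lies between the cells \<open>b\<close> and \<open>b + 1\<close>. Directions need not be recorded,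
  since the crossings alternate and the side on which the run starts is known.
\<close>

fun crossings :: "'a machine \<Rightarrow> nat \<Rightarrow> nat \<Rightarrow> 'a config \<Rightarrow> nat list" where
  "crossings M b 0 c = []"
| "crossings M b (Suc k) c =
     (if (head c \<le> b) = (head (step M c) \<le> b) then [] else [fst (step M c)])
       @ crossings M b k (step M c)"

declare step.simps [simp del]

lemma no_crossing:
  assumes "crossings M b k c = []" and "i \<le> k"
  shows "(head ((step M ^^ i) c) \<le> b) = (head c \<le> b)"
  using assms
proof (induction k arbitrary: c i)
  case (Suc k)
  then show ?case
    by (cases i) (auto split: if_splits simp: funpow_Suc_right simp del: funpow.simps(2))
qed auto

text \<open>
  Up to and including its first crossing of a boundary, a run does not touch the cells beyond
  the boundary. So the far side can be left waiting while the near side is run up to that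
  crossing; this is the step by which the two halves of a cut run alternate below.
\<close>

lemma next_crossing:
  assumes "crossings M b k c = r # rest"
  obtains j where "j < k" and "fst ((step M ^^ Suc j) c) = r"
    and "crossings M b (k - Suc j) ((step M ^^ Suc j) c) = rest"
    and "\<And>i. i \<le> j \<Longrightarrow> (head ((step M ^^ i) c) \<le> b) = (head c \<le> b)"
    and "(head ((step M ^^ Suc j) c) \<le> b) \<noteq> (head c \<le> b)"
    and "\<And>i. (i \<le> b) \<noteq> (head c \<le> b) \<Longrightarrow> tape ((step M ^^ Suc j) c) i = tape c i"
proof -
  have "\<exists>j<k. fst ((step M ^^ Suc j) c) = r
    \<and> crossings M b (k - Suc j) ((step M ^^ Suc j) c) = rest
    \<and> (\<forall>i\<le>j. (head ((step M ^^ i) c) \<le> b) = (head c \<le> b))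
    \<and> (head ((step M ^^ Suc j) c) \<le> b) \<noteq> (head c \<le> b)
    \<and> (\<forall>i. (i \<le> b) \<noteq> (head c \<le> b) \<longrightarrow> tape ((step M ^^ Suc j) c) i = tape c i)"
    using assms
  proof (induction k arbitrary: c)
    case (Suc k)
    have tp: "tape (step M c) i = tape c i" if "(i \<le> b) \<noteq> (head c \<le> b)" for i
      using that by (intro tape_step) auto
    show ?case
    proof (cases "(head c \<le> b) = (head (step M c) \<le> b)")
      case True
      with Suc.prems have "crossings M b k (step M c) = r # rest" by simp
      from Suc.IH[OF this] obtain j where j: "j < k"
        "fst ((step M ^^ Suc j) (step M c)) = r"
        "crossings M b (k - Suc j) ((step M ^^ Suc j) (step M c)) = rest"
        "\<And>i. i \<le> j \<Longrightarrow> (head ((step M ^^ i) (step M c)) \<le> b) = (head (step M c) \<le> b)"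
        "(head ((step M ^^ Suc j) (step M c)) \<le> b) \<noteq> (head (step M c) \<le> b)"
        "\<And>i. (i \<le> b) \<noteq> (head (step M c) \<le> b) \<Longrightarrow>
           tape ((step M ^^ Suc j) (step M c)) i = tape (step M c) i"
        by blast
      have sh: "(step M ^^ Suc i) c = (step M ^^ i) (step M c)" for i
        by (simp add: funpow_swap1)
      have "(head ((step M ^^ i) c) \<le> b) = (head c \<le> b)" if "i \<le> Suc j" for i
        using that j(4) True by (cases i) (simp_all only: sh, auto)
      then show ?thesis
        using j True tp by (intro exI[of _ "Suc j"]) (simp only: sh, auto)
    next
      case False
      with Suc.prems tp show ?thesis by (intro exI[of _ 0]) auto
    qed
  qed simp
  then show ?thesis using that by blast
qed

text \<open>
  Each side of a boundary learns about the other side only through the states in which the head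
  enters. If two boundaries of one run have the same crossing sequence, the left side of the
  first and the right side of the second therefore fit together to a run in which the cells in
  between are missing, and every position that the head reaches beyond the second boundary is
  reached, translated, in this shorter run.

  For the induction the two halves are taken from two configurations, with separate numbers
  of remaining steps: the left half from the first one, the right half from the second one.
  The two are equally far in the common crossing sequence, and the half that does not contain
  the head waits in the configuration in which the head left it. The induction is on the total
  number of remaining steps.
\<close>

lemma cut_between_equal_crossings:
  assumes "crossings M p k1 (q1, h1, tp1) = crossings M (p + d) k2 (q2, h2, tp2)"
    and "\<And>i. i \<le> p \<Longrightarrow> tp i = tp1 i" and "\<And>i. p < i \<Longrightarrow> tp i = tp2 (i + d)"
    and "h1 \<le> p \<and> h2 \<le> p + d \<and> q = q1 \<and> h = h1 \<or>
         p < h1 \<and> p + d < h2 \<and> q = q2 \<and> h + d = h2"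
    and "j \<le> k2" and "p + d < head ((step M ^^ j) (q2, h2, tp2))"
  shows "\<exists>t. head ((step M ^^ t) (q, h, tp)) + d = head ((step M ^^ j) (q2, h2, tp2))"
  using assms
proof (induction "k1 + k2" arbitrary: k1 k2 q1 h1 tp1 q2 h2 tp2 q h tp j rule: less_induct)
  case less
  define c1 c2 c where "c1 = (q1, h1, tp1)" and "c2 = (q2, h2, tp2)" and "c = (q, h, tp)"
  note defs = c1_def c2_def c_def
  \<comment> \<open>The induction hypothesis, after \<open>a\<close> of the \<open>k1\<close> steps, \<open>e\<close> of the \<open>k2\<close> steps
    and one step of the shortened computation.\<close>
  have continue: "\<exists>t. head ((step M ^^ t) c) + d = head ((step M ^^ j) c2)"
    if "a \<le> k1" "e \<le> k2" "0 < a + e" "e \<le> j"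
      and "crossings M p (k1 - a) ((step M ^^ a) c1) = crossings M (p + d) (k2 - e) ((step M ^^ e) c2)"
      and "\<And>i. i \<le> p \<Longrightarrow> tape (step M c) i = tape ((step M ^^ a) c1) i"
      and "\<And>i. p < i \<Longrightarrow> tape (step M c) i = tape ((step M ^^ e) c2) (i + d)"
      and "head ((step M ^^ a) c1) \<le> p \<and> head ((step M ^^ e) c2) \<le> p + d \<and>
             fst (step M c) = fst ((step M ^^ a) c1) \<and> head (step M c) = head ((step M ^^ a) c1) \<or>
           p < head ((step M ^^ a) c1) \<and> p + d < head ((step M ^^ e) c2) \<and>
             fst (step M c) = fst ((step M ^^ e) c2) \<and> head (step M c) + d = head ((step M ^^ e) c2)"
    for a e
  proof -
    have j: "(step M ^^ (j - e)) ((step M ^^ e) c2) = (step M ^^ j) c2"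
      using that(4) by (metis add.commute comp_apply funpow_add le_add_diff_inverse)
    obtain q1' h1' tp1' where c1': "(step M ^^ a) c1 = (q1', h1', tp1')" by (metis prod_cases3)
    obtain q2' h2' tp2' where c2': "(step M ^^ e) c2 = (q2', h2', tp2')" by (metis prod_cases3)
    obtain q' h' tp' where c': "step M c = (q', h', tp')" by (metis prod_cases3)
    have "\<exists>t. head ((step M ^^ t) (q', h', tp')) + d = head ((step M ^^ (j - e)) (q2', h2', tp2'))"
      using that less.prems(5,6) j
      unfolding c1' c2' c'
      by (intro less.hyps[of "k1 - a" "k2 - e" q1' h1' tp1']) (auto simp: defs)
    then show ?thesis
      using j c' c2' by (metis comp_apply funpow_Suc_right)
  qed
  have goal: "\<exists>t. head ((step M ^^ t) c) + d = head ((step M ^^ j) c2)"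
    using less.prems(4)
  proof
    assume L: "h1 \<le> p \<and> h2 \<le> p + d \<and> q = q1 \<and> h = h1"
    \<comment> \<open>The right half still has to be reached, so the common crossing sequence is not exhausted.\<close>
    have "k1 \<noteq> 0"
    proof
      assume "k1 = 0"
      then have "crossings M (p + d) k2 c2 = []" using less.prems(1) by (simp add: defs)
      from no_crossing[OF this less.prems(5)] L less.prems(6) show False by (simp add: defs)
    qed
    then obtain k where k: "k1 = Suc k" by (cases k1) auto
    have loc: "fst (step M c) = fst (step M c1)" "head (step M c) = head (step M c1)"
        "tape (step M c) h = tape (step M c1) h1"
      using step_eq_shifted[of tp h tp1 h1 0] L less.prems(2)[of h] unfolding defs by fastforce+
    have left: "tape (step M c) i = tape (step M c1) i" if "i \<le> p" for i
      using that loc(3) L less.prems(2)[OF that] tape_step[of i c M] tape_step[of i c1 M]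
      by (cases "i = h") (auto simp: defs)
    have right: "tape (step M c) i = tp2 (i + d)" if "p < i" for i
      using that L less.prems(3)[OF that] tape_step[of i c M] by (auto simp: defs)
    \<comment> \<open>If the head stays on the left, only the left half advances; if it crosses, the right half
      is also run up to its next crossing, which has the same state.\<close>
    show ?thesis
    proof (cases "head (step M c1) \<le> p")
      case True
      have "crossings M p k (step M c1) = crossings M (p + d) k2 c2"
        using less.prems(1) True L by (simp add: k defs)
      then show ?thesis
        using True left right loc L
        by (intro continue[of 1 0]) (auto simp: k defs)
    next
      case False
      have "crossings M (p + d) k2 c2 = fst (step M c1) # crossings M p k (step M c1)"
        using less.prems(1) False L by (simp add: k defs)
      then obtain e where e: "e < k2" "fst ((step M ^^ Suc e) c2) = fst (step M c1)"
        "crossings M (p + d) (k2 - Suc e) ((step M ^^ Suc e) c2) = crossings M p k (step M c1)"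
        "\<And>i. i \<le> e \<Longrightarrow> (head ((step M ^^ i) c2) \<le> p + d) = (head c2 \<le> p + d)"
        "(head ((step M ^^ Suc e) c2) \<le> p + d) \<noteq> (head c2 \<le> p + d)"
        "\<And>i. (i \<le> p + d) \<noteq> (head c2 \<le> p + d) \<Longrightarrow> tape ((step M ^^ Suc e) c2) i = tape c2 i"
        by (rule next_crossing) blast
      have "head ((step M ^^ Suc e) c2) = p + d + 1"
        using e(4)[of e] e(5) head_step(1)[of M "(step M ^^ e) c2"]
          head_step(2)[of "(step M ^^ e) c2" M] L
        by (auto simp: defs)
      moreover have "head (step M c1) = p + 1"
        using False head_step(1)[of M c1] L by (simp add: defs)
      moreover have "Suc e \<le> j"
        using e(4)[of j] L less.prems(6) by (cases "Suc e \<le> j") (auto simp: defs)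
      moreover have "tape (step M c) i = tape ((step M ^^ Suc e) c2) (i + d)" if "p < i" for i
        using e(6)[of "i + d"] L that right[OF that] by (simp add: defs)
      ultimately show ?thesis
        using e(1,2,3) left loc
          by (intro continue[of 1 "Suc e"]) (simp_all add: k del: funpow.simps(2), simp_all)
    qed
  next
    assume R: "p < h1 \<and> p + d < h2 \<and> q = q2 \<and> h + d = h2"
    show ?thesis
    proof (cases j)
      case 0
      then show ?thesis using R by (intro exI[of _ 0]) (simp add: defs)
    next
      case (Suc j')
      then obtain k where k: "k2 = Suc k" using less.prems(5) by (cases k2) auto
      have hp: "p < h" using R by simp
      have loc: "fst (step M c) = fst (step M c2)" "head (step M c) + d = head (step M c2)"
          "tape (step M c) h = tape (step M c2) h2"
        using step_eq_shifted[of tp h tp2 h2 d] R hp less.prems(3)[OF hp] unfolding defs by fastforce+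
      have right: "tape (step M c) i = tape (step M c2) (i + d)" if "p < i" for i
        using that loc(3) R less.prems(3)[OF that] tape_step[of i c M] tape_step[of "i + d" c2 M]
        by (cases "i = h") (auto simp: defs)
      have left: "tape (step M c) i = tp1 i" if "i \<le> p" for i
        using that hp less.prems(2)[OF that] tape_step[of i c M] by (auto simp: defs)
      show ?thesis
      proof (cases "p + d < head (step M c2)")
        case True
        have "crossings M (p + d) k (step M c2) = crossings M p k1 c1"
          using less.prems(1) True R by (simp add: k defs)
        then show ?thesis
          using True left right loc R Suc
          by (intro continue[of 0 1]) (auto simp: k defs)
      next
        case False
        have "crossings M p k1 c1 = fst (step M c2) # crossings M (p + d) k (step M c2)"
          using less.prems(1) False R by (simp add: k defs)
        then obtain a where a: "a < k1" "fst ((step M ^^ Suc a) c1) = fst (step M c2)"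
          "crossings M p (k1 - Suc a) ((step M ^^ Suc a) c1) = crossings M (p + d) k (step M c2)"
          "\<And>i. i \<le> a \<Longrightarrow> (head ((step M ^^ i) c1) \<le> p) = (head c1 \<le> p)"
          "(head ((step M ^^ Suc a) c1) \<le> p) \<noteq> (head c1 \<le> p)"
          "\<And>i. (i \<le> p) \<noteq> (head c1 \<le> p) \<Longrightarrow> tape ((step M ^^ Suc a) c1) i = tape c1 i"
          by (rule next_crossing) blast
        have "head ((step M ^^ Suc a) c1) = p"
          using a(4)[of a] a(5) head_step(1)[of M "(step M ^^ a) c1"]
            head_step(2)[of "(step M ^^ a) c1" M] R
          by (auto simp: defs)
        moreover have "head (step M c2) = p + d"
          using False head_step(2)[of c2 M] R by (simp add: defs)
        moreover have "tape (step M c) i = tape ((step M ^^ Suc a) c1) i" if "i \<le> p" for i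
          using a(6)[of i] R that left[OF that] by (simp add: defs)
        ultimately show ?thesis
          using a(1,2,3) right loc Suc
          by (intro continue[of "Suc a" 1]) (simp_all add: k del: funpow.simps(2), simp_all)
      qed
    qed
  qed
  then show ?case by (simp add: defs)
qed

section \<open>Linear time bounds the head excess\<close>

definition legal :: "'a machine \<Rightarrow> 'a config \<Rightarrow> bool" where
  "legal M c \<longleftrightarrow> fst c \<in> states M \<and> range (tape c) \<subseteq> alphabet M \<and> (\<forall>i. tape c i = Marker \<longleftrightarrow> i = 0)"

lemma legal_step:
  assumes "pf_machine X M" and "legal M c"
  shows "legal M (step M c)"
proof -
  obtain q h tp where c: "c = (q, h, tp)" by (cases c)
  obtain q' b d where \<delta>: "delta M q (tp h) = (q', b, d)" by (metis prod_cases3)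
  have "q \<in> states M" "tp h \<in> alphabet M" using assms(2) by (auto simp: legal_def c)
  then have "q' \<in> states M \<and> b \<in> alphabet M \<and> (b = Marker \<longleftrightarrow> tp h = Marker)"
    using assms(1) \<delta> unfolding pf_machine_def by blast
  then show ?thesis
    using assms(2) \<delta> by (auto simp: legal_def c step.simps)
qed

lemma legal_steps: "pf_machine X M \<Longrightarrow> legal M c \<Longrightarrow> legal M ((step M ^^ t) c)"
  by (induction t) (auto intro: legal_step)

lemma legal_initial: "pf_machine X M \<Longrightarrow> x \<in> lists X \<Longrightarrow> legal M (initial_config M x)"
  by (auto simp: legal_def initial_config_def initial_tape_def pf_machine_def
      dest!: in_listsD intro!: subsetD[of "Letter ` X" "alphabet M"])

lemma halted: "fst c \<in> accepting M \<Longrightarrow> (step M ^^ t) c = c"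
proof (induction t)
  case (Suc t)
  then show ?case by (cases c) (auto simp: step.simps)
qed simp

lemma halted_later:
  assumes "fst ((step M ^^ k) c) \<in> accepting M" and "k \<le> t"
  shows "(step M ^^ t) c = (step M ^^ k) c"
  using halted[OF assms(1), of "t - k"] assms(2)
  by (metis comp_apply funpow_add le_add_diff_inverse2)

lemma crossings_in_states:
  "pf_machine X M \<Longrightarrow> legal M c \<Longrightarrow> set (crossings M b k c) \<subseteq> states M"
proof (induction k arbitrary: c)
  case (Suc k)
  have "legal M (step M c)" using Suc.prems by (rule legal_step)
  with Suc.IH[OF Suc.prems(1) this] show ?case by (simp add: legal_def)
qed simp

text \<open>
One step crosses at most one boundary.
\<close>

lemma sum_crossings: "(\<Sum>b<n. length (crossings M b k c)) \<le> k"
proof (induction k arbitrary: c)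
  case (Suc k)
  let ?m = "min (head c) (head (step M c))"
  have "(\<Sum>b<n. length (crossings M b (Suc k) c)) \<le>
      (\<Sum>b<n. (if b = ?m then 1 else 0) + length (crossings M b k (step M c)))"
    using head_step(1)[of M c] head_step(2)[of c M] by (intro sum_mono) auto
  also have "\<dots> \<le> 1 + (\<Sum>b<n. length (crossings M b k (step M c)))"
    by (simp add: sum.distrib)
  finally show ?case using Suc[of "step M c"] by simp
qed simp

text \<open>
  The average length of the lists is at most \<open>C\<close>, so at least half of them have length at most
  \<open>2 * C\<close>; if there are more of these than lists of that length, two of them coincide.
\<close>

lemma repeated_short_list:
  fixes cs :: "nat \<Rightarrow> 'q list"
  assumes "finite Q" and "\<And>b. set (cs b) \<subseteq> Q" and "(\<Sum>b<n. length (cs b)) \<le> C * n"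
    and "2 * card {l. set l \<subseteq> Q \<and> length l \<le> 2 * C} < n"
  obtains p d where "0 < d" and "p + d < n" and "cs p = cs (p + d)"
proof -
  define good where "good = {b. b < n \<and> length (cs b) \<le> 2 * C}"
  define bad where "bad = {b. b < n \<and> 2 * C < length (cs b)}"
  have "(2 * C + 1) * card bad = (\<Sum>b\<in>bad. 2 * C + 1)" by simp
  also have "\<dots> \<le> (\<Sum>b\<in>bad. length (cs b))"
    by (intro sum_mono) (auto simp: bad_def)
  also have "\<dots> \<le> (\<Sum>b<n. length (cs b))"
    by (intro sum_mono2) (auto simp: bad_def)
  finally have "(2 * C + 1) * card bad \<le> C * n" using assms(3) by linarith
  then have "2 * card bad * (2 * C + 1) \<le> n * (2 * C + 1)" by (simp add: algebra_simps)
  then have "2 * card bad \<le> n" by (simp only: mult_le_cancel2)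
  moreover have "card good + card bad = card {..<n}"
  proof (subst card_Un_disjoint[symmetric])
    show "card (good \<union> bad) = card {..<n}"
      by (rule arg_cong[of _ _ card]) (auto simp: good_def bad_def)
  qed (auto simp: good_def bad_def)
  ultimately have "card {l. set l \<subseteq> Q \<and> length l \<le> 2 * C} < card good"
    using assms(4) by simp
  then have "\<not> inj_on cs good"
    using card_inj_on_le[of cs good "{l. set l \<subseteq> Q \<and> length l \<le> 2 * C}"]
      assms(2) finite_lists_length_le[OF assms(1)] by (force simp: good_def)
  then obtain p q where "p \<in> good" "q \<in> good" "p < q" "cs p = cs q"
    unfolding inj_on_def by (metis linorder_neqE_nat)
  then show ?thesis
    using that[of "q - p" p] by (auto simp: good_def)
qed

lemma initial_tape_cut:
  assumes "p + d < length x"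
  shows "i \<le> p \<Longrightarrow> initial_tape (take p x @ drop (p + d) x) i = initial_tape x i"
    and "p < i \<Longrightarrow> initial_tape (take p x @ drop (p + d) x) i = initial_tape x (i + d)"
proof -
  show "initial_tape (take p x @ drop (p + d) x) i = initial_tape x i" if "i \<le> p"
    using that assms by (cases i) (auto simp: initial_tape_def nth_append)
  have "i - 1 - p + (p + d) = i + d - 1" if "p < i" using that by simp
  then show "initial_tape (take p x @ drop (p + d) x) i = initial_tape x (i + d)" if "p < i"
    using that assms by (auto simp: initial_tape_def nth_append add.commute)
qed

lemma linear_bound:
  assumes "(\<lambda>n. real (T n)) \<in> O(\<lambda>n. real n)"
  obtains C n0 where "\<And>n. n0 \<le> n \<Longrightarrow> T n \<le> C * n"
proof -
  obtain C' where "eventually (\<lambda>n. norm (real (T n)) \<le> C' * norm (real n)) sequentially"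
    using assms by (auto elim: landau_o.bigE)
  then obtain n0 where n0: "\<And>n. n0 \<le> n \<Longrightarrow> real (T n) \<le> C' * real n"
    by (auto simp: eventually_sequentially)
  define C where "C = nat \<lceil>C'\<rceil>"
  have "real (T n) \<le> real C * real n" if "n0 \<le> n" for n
    using n0[OF that] by (rule order_trans) (intro mult_right_mono; simp add: C_def real_nat_ceiling_ge)
  then have "T n \<le> C * n" if "n0 \<le> n" for n
    using that by (metis of_nat_le_iff of_nat_mult)
  then show ?thesis by (rule that)
qed

text \<open>
  If the time is at most \<open>C\<close> times the input length, then half of the boundaries inside the
  input are crossed at most \<open>2 * C\<close> times. On a long input two of these have the same crossing
  sequence, and cutting out the cells between them gives a shorter input on which the head
  runs equally far beyond the end of the input. Hence the head excess on any input already
  occurs on one of the finitely many short ones. This is the point where linear time is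
  needed: it makes the output longer than the input by a bounded amount only.
\<close>

lemma linear_time_head_bound:
  assumes M: "pf_machine X M" and T: "(\<lambda>n. real (T n)) \<in> O(\<lambda>n. real n)"
    and halts: "\<And>x. x \<in> lists X \<Longrightarrow> \<exists>k\<le>T (length x). fst ((step M ^^ k) (initial_config M x)) \<in> accepting M"
  obtains c where "\<And>x t. x \<in> lists X \<Longrightarrow> head ((step M ^^ t) (initial_config M x)) \<le> length x + c"
proof -
  have stop: "(step M ^^ t) (initial_config M x) = (step M ^^ min t (T (length x))) (initial_config M x)"
    if x: "x \<in> lists X" for x t
  proof -
    obtain k where k: "k \<le> T (length x)" "fst ((step M ^^ k) (initial_config M x)) \<in> accepting M"
      using halts[OF x] by blast
    show ?thesis
    proof (cases "t \<le> T (length x)")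
      case False
      with k(1) have "k \<le> t" by simp
      with False show ?thesis
        using halted_later[OF k(2) k(1)] halted_later[OF k(2) \<open>k \<le> t\<close>] by simp
    qed simp
  qed
  obtain C n0 where lin: "\<And>n. n0 \<le> n \<Longrightarrow> T n \<le> C * n"
    using linear_bound[OF T] by blast
  define K where "K = 2 * card {l. set l \<subseteq> states M \<and> length l \<le> 2 * C}"
  define c where "c = (\<Sum>n\<le>n0 + K. T n)"
  have "head ((step M ^^ t) (initial_config M x)) \<le> length x + c" if "x \<in> lists X" for x t
    using that
  proof (induction "length x" arbitrary: x t rule: less_induct)
    case less
    define cx where "cx = initial_config M x"
    show ?case
    proof (cases "length x \<le> n0 + K")
      case True
      have "head ((step M ^^ t) cx) \<le> T (length x)"
        using stop[OF less.prems, of t] head_steps[of "min t (T (length x))" M cx]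
        by (simp add: cx_def initial_config_def)
      also have "\<dots> \<le> c"
        unfolding c_def using True by (intro member_le_sum) auto
      finally show ?thesis by (simp add: cx_def)
    next
      case False
      define n where "n = length x"
      have leg: "legal M cx" unfolding cx_def by (rule legal_initial[OF M less.prems])
      have sum: "(\<Sum>b<n. length (crossings M b (T n) cx)) \<le> C * n"
        using sum_crossings[where n = n and k = "T n" and c = cx and M = M] lin[of n] False
        by (simp add: n_def)
      have fin: "finite (states M)" using M by (simp add: pf_machine_def)
      have large: "2 * card {l. set l \<subseteq> states M \<and> length l \<le> 2 * C} < n"
        using False by (simp add: K_def n_def)
      obtain p d where pd: "0 < d" "p + d < n"
          "crossings M p (T n) cx = crossings M (p + d) (T n) cx"
        by (rule repeated_short_list[OF fin crossings_in_states[OF M leg] sum large])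
      define y where "y = take p x @ drop (p + d) x"
      have y: "y \<in> lists X" "length y + d = length x"
        using less.prems pd(2) by (auto simp: y_def n_def dest: in_set_takeD in_set_dropD)
      define j where "j = min t (T n)"
      have j: "(step M ^^ t) cx = (step M ^^ j) cx"
        using stop[OF less.prems, of t] by (simp add: cx_def j_def n_def)
      show ?thesis
      proof (cases "head ((step M ^^ j) cx) \<le> n")
        case True
        then show ?thesis using j by (simp add: cx_def n_def)
      next
        case far: False
        have pd': "p + d < length x" using pd(2) by (simp add: n_def)
        have "\<exists>t'. head ((step M ^^ t') (start M, 0, initial_tape y)) + d =
            head ((step M ^^ j) (start M, 0, initial_tape x))"
        proof (rule cut_between_equal_crossings)
          show "crossings M p (T n) (start M, 0, initial_tape x) =
              crossings M (p + d) (T n) (start M, 0, initial_tape x)"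
            using pd(3) by (simp add: cx_def initial_config_def)
          show "p + d < head ((step M ^^ j) (start M, 0, initial_tape x))"
            using far pd(2) by (simp add: cx_def initial_config_def)
          show "initial_tape y i = initial_tape x i" if "i \<le> p" for i
            using initial_tape_cut(1)[OF pd' that] by (simp add: y_def)
          show "initial_tape y i = initial_tape x (i + d)" if "p < i" for i
            using initial_tape_cut(2)[OF pd' that] by (simp add: y_def)
        qed (auto simp: j_def)
        then obtain t' where t': "head ((step M ^^ t') (initial_config M y)) + d = head ((step M ^^ j) cx)"
          unfolding initial_config_def cx_def by blast
        have "head ((step M ^^ t') (initial_config M y)) \<le> length y + c"
          using y pd(1) by (intro less.hyps) auto
        then show ?thesis using t' y(2) j by (simp add: cx_def)
      qed
    qed
  qed
  then show ?thesis by (rule that)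
qed

section \<open>Machines over arbitrary states and symbols\<close>

text \<open>
  A machine with states and tape symbols of arbitrary types, so that the program below can be
  written with structured states and with symbols that have two tracks; \<open>realize_machine\<close>
  numbers the states and encodes the symbols.
\<close>

definition gstep ::
  "('q \<Rightarrow> 'z \<Rightarrow> 'q \<times> 'z \<times> move) \<Rightarrow> 'q set \<Rightarrow> 'q \<times> nat \<times> (nat \<Rightarrow> 'z) \<Rightarrow> 'q \<times> nat \<times> (nat \<Rightarrow> 'z)" where
  "gstep \<delta> F = (\<lambda>(q, h, tp). if q \<in> F then (q, h, tp)
     else case \<delta> q (tp h) of (q', z, d) \<Rightarrow> (q', move_head d h, tp(h := z)))"

lemma realize_machine:
  fixes \<delta> :: "'q \<Rightarrow> 'z \<Rightarrow> 'q \<times> 'z \<times> move" and \<iota> :: "'z \<Rightarrow> 'a cell"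
  assumes "finite Q" and "finite Z" and "q0 \<in> Q" and "F \<subseteq> Q" and "inj_on \<iota> Z"
    and alphabet: "insert Marker (insert Blank (Letter ` X)) \<subseteq> \<iota> ` Z"
    and closed: "\<And>q z q' z' d. q \<in> Q \<Longrightarrow> z \<in> Z \<Longrightarrow> \<delta> q z = (q', z', d) \<Longrightarrow>
      q' \<in> Q \<and> z' \<in> Z \<and> (\<iota> z' = Marker \<longleftrightarrow> \<iota> z = Marker) \<and> (\<iota> z = Marker \<longrightarrow> d \<noteq> MoveLeft)"
  obtains M where "pf_machine X M"
    and "\<And>k h tp q' h' tp'. range tp \<subseteq> Z \<Longrightarrow> (gstep \<delta> F ^^ k) (q0, h, tp) = (q', h', tp') \<Longrightarrow> q' \<in> F \<Longrightarrow>
      \<exists>e. (step M ^^ k) (start M, h, \<iota> \<circ> tp) = (e, h', \<iota> \<circ> tp') \<and> e \<in> accepting M"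
proof -
  obtain en :: "'q \<Rightarrow> nat" where en: "inj_on en Q"
    using finite_imp_inj_to_nat_seg[OF assms(1)] by blast
  define M :: "'a machine" where "M = \<lparr>states = en ` Q, alphabet = \<iota> ` Z, start = en q0, accepting = en ` F,
    delta = (\<lambda>n a. case \<delta> (inv_into Q en n) (inv_into Z \<iota> a) of (q', z', d) \<Rightarrow> (en q', \<iota> z', d))\<rparr>"
  have delta: "delta M (en q) (\<iota> z) = (case \<delta> q z of (q', z', d) \<Rightarrow> (en q', \<iota> z', d))"
    if "q \<in> Q" "z \<in> Z" for q z
    using that en assms(5) by (simp add: M_def)
  have pf: "pf_machine X M"
    unfolding pf_machine_def
  proof (intro conjI ballI allI impI)
    fix n a q' b d
    assume "n \<in> states M" "a \<in> alphabet M" and \<delta>: "delta M n a = (q', b, d)"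
    then obtain q z where qz: "q \<in> Q" "n = en q" "z \<in> Z" "a = \<iota> z" by (auto simp: M_def)
    obtain q1 z1 d1 where *: "\<delta> q z = (q1, z1, d1)" by (metis prod_cases3)
    have "q' = en q1" "b = \<iota> z1" "d = d1"
      using \<delta> delta[OF qz(1,3)] * by (simp_all add: qz)
    then show "q' \<in> states M" "b \<in> alphabet M" "(b = Marker) = (a = Marker)"
        "a = Marker \<Longrightarrow> d \<noteq> MoveLeft"
      using closed[OF qz(1,3) *] qz by (auto simp: M_def)
  qed (use assms(1-4) alphabet in \<open>auto simp: M_def\<close>)
  have step: "step M (en q, h, \<iota> \<circ> tp) = (en q', h', \<iota> \<circ> tp') \<and> q' \<in> Q \<and> range tp' \<subseteq> Z"
    if "q \<in> Q" "range tp \<subseteq> Z" "gstep \<delta> F (q, h, tp) = (q', h', tp')" for q h tp q' h' tp'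
  proof -
    have acc: "en q \<in> accepting M \<longleftrightarrow> q \<in> F"
      using that(1) en assms(4) by (auto simp: M_def inj_on_def)
    obtain q1 z1 d1 where *: "\<delta> q (tp h) = (q1, z1, d1)" by (metis prod_cases3)
    have z: "tp h \<in> Z" using that(2) by auto
    show ?thesis
      using that acc * delta[OF that(1) z] closed[OF that(1) z *]
      by (auto simp: step.simps gstep_def fun_upd_comp image_subset_iff)
  qed
  have run: "(step M ^^ k) (en q0, h, \<iota> \<circ> tp) = (en q', h', \<iota> \<circ> tp') \<and> q' \<in> Q \<and> range tp' \<subseteq> Z"
    if "range tp \<subseteq> Z" "(gstep \<delta> F ^^ k) (q0, h, tp) = (q', h', tp')" for k h tp q' h' tp'
    using that(2)
  proof (induction k arbitrary: q' h' tp')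
    case 0
    then show ?case using that assms(3) by auto
  next
    case (Suc k)
    obtain q1 h1 tp1 where 1: "(gstep \<delta> F ^^ k) (q0, h, tp) = (q1, h1, tp1)" by (metis prod_cases3)
    from Suc.IH[OF 1] step[of q1 tp1 h1 q' h' tp'] Suc.prems 1 show ?case by (simp add: comp_def)
  qed
  show ?thesis
  proof (rule that[OF pf])
    fix k h tp q' h' tp'
    assume "range tp \<subseteq> Z" "(gstep \<delta> F ^^ k) (q0, h, tp) = (q', h', tp')" "q' \<in> F"
    with run[OF this(1,2)]
    have "(step M ^^ k) (start M, h, \<iota> \<circ> tp) = (en q', h', \<iota> \<circ> tp')" "en q' \<in> accepting M"
      by (simp_all add: M_def)
    then show "\<exists>e. (step M ^^ k) (start M, h, \<iota> \<circ> tp) = (e, h', \<iota> \<circ> tp') \<and> e \<in> accepting M"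
      by blast
  qed
qed

section \<open>The iterating machine\<close>

text \<open>
  Every cell carries an input track with the letters that have not been consumed and a work
  track on which the machines are simulated. A cell that has never been visited still holds
  \<open>UIn\<close> or \<open>UBlank\<close>, so \<open>UBlank\<close> marks the end of the used part of the tape, in contrast to
  a blank \<open>UPair None Blank\<close> on the work track. \<open>UOut\<close> cells hold the final output.
\<close>

datatype ('g, 's) sym = UMarker | UBlank | UIn 'g | UOut 's | UPair "'g option" "'s cell"

fun inp :: "('g, 's) sym \<Rightarrow> 'g option" where
  "inp (UIn g) = Some g"
| "inp (UPair i b) = i"
| "inp _ = None"

fun sim :: "('g, 's) sym \<Rightarrow> 's cell" where
  "sim UMarker = Marker"
| "sim (UPair i b) = b"
| "sim (UOut a) = Letter a"
| "sim _ = Blank"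

text \<open>
  \<open>Init ws\<close> still has to write \<open>ws\<close>; \<open>Rew q\<close> returns to the marker and continues in \<open>q\<close>.
  \<open>Sweep e i\<close> walks over the used part of the tape: \<open>e\<close> says whether the first blank of the work
  track has been passed, so that everything further right is garbage, and \<open>i\<close> is the input
  letter consumed on the way, if any. \<open>Sim g q\<close> simulates state \<open>q\<close> of the machine for \<open>g\<close>,
  and \<open>Fin\<close> turns the word on the work track into the output.
\<close>

datatype ('g, 's) ctl =
  Init "'s list" | Rew "('g, 's) ctl" | Sweep bool "'g option" | Sim 'g nat | Fin | Halt

abbreviation loop :: "('g, 's) ctl" where
  "loop \<equiv> Rew (Sweep False None)"

definition input_tape :: "'g list \<Rightarrow> nat \<Rightarrow> ('g, 's) sym" where
  "input_tape v i = (if i = 0 then UMarker else if i \<le> length v then UIn (v ! (i - 1)) else UBlank)"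

definition used :: "nat \<Rightarrow> (nat \<Rightarrow> ('g, 's) sym) \<Rightarrow> bool" where
  "used R tp \<longleftrightarrow> tp 0 = UMarker \<and> (\<forall>i. 0 < i \<and> i \<le> R \<longrightarrow> tp i \<noteq> UMarker \<and> tp i \<noteq> UBlank) \<and>
     (\<forall>i>R. tp i = UBlank)"

definition inputs :: "'g list \<Rightarrow> nat \<Rightarrow> (nat \<Rightarrow> ('g, 's) sym) \<Rightarrow> bool" where
  "inputs v j tp \<longleftrightarrow>
     (\<forall>i>0. inp (tp i) = (if j < i \<and> i \<le> length v then Some (v ! (i - 1)) else None))"

lemma tape_output_iff:
  "tape_output tp y \<longleftrightarrow> tp 0 = Marker \<and> (\<forall>i. 0 < i \<and> i \<le> length y \<longrightarrow> tp i = Letter (y ! (i - 1))) \<and>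
     tp (length y + 1) = Blank"
proof -
  have "tape_output tp y \<longleftrightarrow>
      (\<forall>i<Suc (Suc (length y)). tp i = (Marker # map Letter y @ [Blank]) ! i)"
    unfolding tape_output_def list_eq_iff_nth_eq by (simp del: upt_Suc)
  also have "\<dots> \<longleftrightarrow> tp 0 = Marker \<and> (\<forall>i<length y. tp (Suc i) = Letter (y ! i)) \<and>
      tp (length y + 1) = Blank"
    by (subst All_less_Suc2, subst All_less_Suc) (auto simp: nth_append)
  also have "(\<forall>i<length y. tp (Suc i) = Letter (y ! i)) \<longleftrightarrow>
      (\<forall>i. 0 < i \<and> i \<le> length y \<longrightarrow> tp i = Letter (y ! (i - 1)))"
    by (metis Suc_le_eq diff_Suc_1 gr0_implies_Suc zero_less_Suc)
  finally show ?thesis .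
qed

text \<open>
  The machines \<open>M g\<close> compute \<open>f g\<close> within common linear bounds on the time and a common bound
  \<open>c\<close> on the head excess. The machine built here writes \<open>w0\<close> and then applies, for each letter
  \<open>g\<close> of its input, the machine \<open>M g\<close> to the word on the work track.
\<close>

locale iteration =
  fixes S :: "'g set" and \<Sigma> :: "'s set" and M :: "'g \<Rightarrow> 's machine"
    and f :: "'g \<Rightarrow> 's list \<Rightarrow> 's list" and w0 :: "'s list" and C D c :: nat
  assumes finite_S: "finite S" and finite_\<Sigma>: "finite \<Sigma>" and w0: "w0 \<in> lists \<Sigma>"
    and pf: "g \<in> S \<Longrightarrow> pf_machine \<Sigma> (M g)"
    and f: "g \<in> S \<Longrightarrow> w \<in> lists \<Sigma> \<Longrightarrow> f g w \<in> lists \<Sigma>"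
    and computes: "g \<in> S \<Longrightarrow> w \<in> lists \<Sigma> \<Longrightarrow> outputs_within (M g) w (f g w) (C * length w + D)"
    and head_bound: "g \<in> S \<Longrightarrow> w \<in> lists \<Sigma> \<Longrightarrow>
      head ((step (M g) ^^ t) (initial_config (M g) w)) \<le> length w + c"
begin

text \<open>
  The test for the alphabet in \<open>Sim\<close> is there because the machines have different alphabets but
  share the tape: a foreign symbol could lead \<open>M g\<close> out of its state set. In a run from an
  input over \<open>S\<close> the test never fails.
\<close>

fun \<delta> :: "('g, 's) ctl \<Rightarrow> ('g, 's) sym \<Rightarrow> ('g, 's) ctl \<times> ('g, 's) sym \<times> move" where
  "\<delta> (Init ws) z =
     (if z = UMarker then (Init ws, z, MoveRight)
      else case ws of [] \<Rightarrow> (loop, z, Stay)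
         | a # as \<Rightarrow> (Init as, UPair (inp z) (Letter a), MoveRight))"
| "\<delta> (Rew t) z = (if z = UMarker then (t, z, Stay) else (Rew t, z, MoveLeft))"
| "\<delta> (Sweep e g) z =
     (if z = UMarker then (Sweep e g, z, MoveRight)
      else if z = UBlank then
        (Rew (case g of None \<Rightarrow> Fin | Some s \<Rightarrow> Sim s (start (M s))), z, Stay)
      else (Sweep (e \<or> sim z = Blank) (if g = None then inp z else g),
            UPair (if g = None then None else inp z) (if e then Blank else sim z), MoveRight))"
| "\<delta> (Sim g q) z =
     (if q \<in> accepting (M g) then (loop, z, Stay)
      else if sim z \<notin> alphabet (M g) then (Halt, z, Stay)
      else case delta (M g) q (sim z) of (q', b, d) \<Rightarrow>
        (Sim g q', if z = UMarker then z else UPair (inp z) b, d))"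
| "\<delta> Fin z =
     (if z = UMarker then (Fin, z, MoveRight)
      else case sim z of Letter a \<Rightarrow> (Fin, UOut a, MoveRight) | _ \<Rightarrow> (Halt, UBlank, Stay))"
| "\<delta> Halt z = (Halt, z, Stay)"

definition reach :: "nat \<Rightarrow> ('g, 's) ctl \<times> nat \<times> (nat \<Rightarrow> ('g, 's) sym) \<Rightarrow> _ \<Rightarrow> bool" where
  "reach k cf cf' \<longleftrightarrow> (\<exists>k'\<le>k. (gstep \<delta> {Halt} ^^ k') cf = cf')"

lemma reach_refl: "reach k cf cf"
  unfolding reach_def by (intro exI[of _ 0]) auto

lemma reach_trans: "reach k cf cf' \<Longrightarrow> reach l cf' cf'' \<Longrightarrow> reach (k + l) cf cf''"
proof -
  assume "reach k cf cf'" and "reach l cf' cf''"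
  then obtain m n where "m \<le> k" "(gstep \<delta> {Halt} ^^ m) cf = cf'" "n \<le> l" "(gstep \<delta> {Halt} ^^ n) cf' = cf''"
    unfolding reach_def by blast
  then show "reach (k + l) cf cf''"
    unfolding reach_def by (intro exI[of _ "n + m"]) (simp add: funpow_add)
qed

lemma reach_mono: "reach k cf cf' \<Longrightarrow> k \<le> l \<Longrightarrow> reach l cf cf'"
  unfolding reach_def using order_trans by blast

lemma reach_step: "gstep \<delta> {Halt} cf = cf' \<Longrightarrow> reach 1 cf cf'"
  unfolding reach_def by (intro exI[of _ 1]) auto

lemma gstep_eq:
  "q \<noteq> Halt \<Longrightarrow> \<delta> q (tp h) = (q', z, d) \<Longrightarrow>
    gstep \<delta> {Halt} (q, h, tp) = (q', move_head d h, tp(h := z))"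
  by (simp add: gstep_def)

lemma reach_rewind:
  assumes "used R tp"
  shows "reach (h + 1) (Rew t, h, tp) (t, 0, tp)"
proof (induction h)
  case 0
  have "gstep \<delta> {Halt} (Rew t, 0, tp) = (t, 0, tp)"
    using assms by (subst gstep_eq[where d = Stay]) (auto simp: used_def)
  from reach_step[OF this] show ?case by simp
next
  case (Suc h)
  have "tp (Suc h) \<noteq> UMarker" using assms by (cases "Suc h \<le> R") (auto simp: used_def)
  then have "gstep \<delta> {Halt} (Rew t, Suc h, tp) = (Rew t, h, tp)"
    by (subst gstep_eq[where d = MoveLeft]) auto
  from reach_trans[OF reach_step[OF this] Suc] show ?case by simp
qed

lemma reach_init:
  "\<exists>tp. used (max (length w0) (length v)) tp \<and> inputs v 0 tp \<and> tape_output (sim \<circ> tp) w0 \<and>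
     reach (length w0 + 2) (Init w0, 0, input_tape v) (loop, length w0 + 1, tp)"
proof -
  define tp where "tp k i = (if 0 < i \<and> i \<le> k then UPair (inp (input_tape v i :: ('g, 's) sym)) (Letter (w0 ! (i - 1)))
    else input_tape v i)" for k i
  have "k \<le> length w0 \<Longrightarrow> reach (k + 1) (Init w0, 0, input_tape v) (Init (drop k w0), k + 1, tp k)" for k
  proof (induction k)
    case 0
    have "gstep \<delta> {Halt} (Init w0, 0, input_tape v) = (Init w0, 1, tp 0)"
      by (subst gstep_eq[where d = MoveRight]) (auto simp: input_tape_def tp_def)
    from reach_step[OF this] show ?case by simp
  next
    case (Suc k)
    have "drop k w0 = w0 ! k # drop (Suc k) w0" using Suc.prems by (simp add: Cons_nth_drop_Suc)
    moreover have "tp k (k + 1) = input_tape v (k + 1)" "input_tape v (k + 1) \<noteq> UMarker"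
      by (simp_all add: tp_def input_tape_def)
    moreover have "(tp k)(k + 1 := UPair (inp (input_tape v (k + 1) :: ('g, 's) sym)) (Letter (w0 ! k))) = tp (Suc k)"
      by (auto simp: tp_def fun_eq_iff le_Suc_eq)
    ultimately have "gstep \<delta> {Halt} (Init (drop k w0), k + 1, tp k) = (Init (drop (Suc k) w0), Suc k + 1, tp (Suc k))"
      by (subst gstep_eq[where d = MoveRight]) auto
    from reach_trans[OF Suc.IH reach_step[OF this]] Suc.prems show ?case by simp
  qed
  from this[of "length w0"]
  have "reach (length w0 + 1) (Init w0, 0, input_tape v) (Init [], length w0 + 1, tp (length w0))" by simp
  moreover have "tp (length w0) (length w0 + 1) \<noteq> UMarker"
    by (simp add: tp_def input_tape_def)
  then have "gstep \<delta> {Halt} (Init [], length w0 + 1, tp (length w0)) = (loop, length w0 + 1, tp (length w0))"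
    by (subst gstep_eq[where d = Stay]) auto
  ultimately have "reach (length w0 + 2) (Init w0, 0, input_tape v) (loop, length w0 + 1, tp (length w0))"
    using reach_trans[OF _ reach_step, of "length w0 + 1"] by auto
  moreover have "used (max (length w0) (length v)) (tp (length w0))"
    by (auto simp: used_def tp_def input_tape_def)
  moreover have "inputs v 0 (tp (length w0))"
    by (auto simp: inputs_def tp_def input_tape_def)
  moreover have "tape_output (sim \<circ> tp (length w0)) w0"
    by (auto simp: tape_output_iff tp_def input_tape_def)
  ultimately show ?thesis by blast
qed

text \<open>
  The simulated machine leaves arbitrary symbols behind the first blank, while the next one
  expects blanks there. The sweep erases them; it can stop at the first \<open>UBlank\<close> because
  nothing to the right of it has been visited. After the last letter there is nothing left to
  consume and the sweep leads to the output phase.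
\<close>

lemma reach_sweep:
  assumes used: "used R tp" and inputs: "inputs v j tp" and out: "tape_output (sim \<circ> tp) w"
  shows "\<exists>tp'. used R tp' \<and> inputs v (Suc j) tp' \<and> sim \<circ> tp' = initial_tape w \<and>
     reach (R + 2) (Sweep False None, 0, tp)
       (Rew (if j < length v then Sim (v ! j) (start (M (v ! j))) else Fin), R + 1, tp')"
proof -
  \<comment> \<open>The contents of the cells behind the head, and the states of the sweep, in closed form.\<close>
  define cell where "cell i = UPair (if Suc j < i \<and> i \<le> length v then Some (v ! (i - 1)) else None)
    (if length w + 1 < i then Blank else sim (tp i))" for i
  define tp' where "tp' k i = (if 0 < i \<and> i \<le> k then cell i else tp i)" for k i
  define st :: "nat \<Rightarrow> ('g, 's) ctl" where
    "st k = Sweep (length w < k) (if j < k \<and> j < length v then Some (v ! j) else None)" for k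
  have "k \<le> R \<Longrightarrow> reach (k + 1) (Sweep False None, 0, tp) (st k, k + 1, tp' k)" for k
  proof (induction k)
    case 0
    have "gstep \<delta> {Halt} (Sweep False None, 0, tp) = (st 0, 0 + 1, tp' 0)"
      using used by (subst gstep_eq[where d = MoveRight]) (auto simp: used_def st_def tp'_def)
    from reach_step[OF this] show ?case by simp
  next
    case (Suc k)
    have z: "tp (Suc k) \<noteq> UMarker" "tp (Suc k) \<noteq> UBlank"
      using used Suc.prems by (auto simp: used_def)
    have i: "inp (tp (Suc k)) = (if j < Suc k \<and> Suc k \<le> length v then Some (v ! k) else None)"
      using inputs by (simp add: inputs_def)
    have s: "Suc k \<le> length w \<Longrightarrow> sim (tp (Suc k)) \<noteq> Blank"
         "Suc k = length w + 1 \<Longrightarrow> sim (tp (Suc k)) = Blank"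
      using out by (auto simp: tape_output_iff)
    have "\<delta> (st k) (tp (Suc k)) = (st (Suc k), cell (Suc k), MoveRight)"
      using z i s unfolding st_def cell_def
      by (cases "length w" k rule: linorder_cases; cases j k rule: linorder_cases; simp)
    moreover have "(tp' k)(Suc k := cell (Suc k)) = tp' (Suc k)" "tp' k (Suc k) = tp (Suc k)"
      by (auto simp: tp'_def fun_eq_iff le_Suc_eq)
    ultimately have "gstep \<delta> {Halt} (st k, k + 1, tp' k) = (st (Suc k), Suc k + 1, tp' (Suc k))"
      by (subst gstep_eq[where d = MoveRight]) (auto simp: st_def)
    from reach_trans[OF Suc.IH reach_step[OF this]] Suc.prems show ?case by simp
  qed
  from this[of R] have 1: "reach (R + 1) (Sweep False None, 0, tp) (st R, R + 1, tp' R)" by simp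
  have blank: "tp i = UBlank" if "R < i" for i using used that by (simp add: used_def)
  have "j < R" if "j < length v"
  proof (rule ccontr)
    assume "\<not> j < R"
    then have "tp (Suc j) = UBlank" by (intro blank) simp
    then show False using inputs that by (auto simp: inputs_def dest: spec[of _ "Suc j"])
  qed
  then have "gstep \<delta> {Halt} (st R, R + 1, tp' R) =
      (Rew (if j < length v then Sim (v ! j) (start (M (v ! j))) else Fin), R + 1, tp' R)"
    using blank[of "R + 1"]
    by (subst gstep_eq[where d = Stay]) (auto simp: st_def tp'_def)
  from reach_trans[OF 1 reach_step[OF this]]
  have "reach (R + 2) (Sweep False None, 0, tp)
       (Rew (if j < length v then Sim (v ! j) (start (M (v ! j))) else Fin), R + 1, tp' R)" by simp
  moreover have "used R (tp' R)"
    using used by (auto simp: used_def tp'_def cell_def)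
  moreover have "inputs v (Suc j) (tp' R)"
    unfolding inputs_def
  proof (intro allI impI)
    fix i :: nat assume "0 < i"
    then show "inp (tp' R i) = (if Suc j < i \<and> i \<le> length v then Some (v ! (i - 1)) else None)"
      using inputs[unfolded inputs_def, rule_format, of i] blank[of i]
      by (cases "i \<le> R") (auto simp: tp'_def cell_def split: if_splits)
  qed
  moreover have "(sim \<circ> tp' R) i = initial_tape w i" for i
    using out out[unfolded tape_output_iff, THEN conjunct2, THEN conjunct1, rule_format, of i] blank[of i] used
    by (cases "i \<le> R"; cases "i = length w + 1"; cases "i = 0")
       (auto simp: tp'_def cell_def initial_tape_def tape_output_iff used_def)
  ultimately show ?thesis by blast
qed

lemma sim_step:
  assumes "g \<in> S" and "legal (M g) (q, h, sim \<circ> tp)" and "q \<notin> accepting (M g)"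
    and "used R tp" and "h \<le> R + 1"
    and "step (M g) (q, h, sim \<circ> tp) = (q', h', stp)"
  shows "\<exists>tp'. gstep \<delta> {Halt} (Sim g q, h, tp) = (Sim g q', h', tp') \<and> sim \<circ> tp' = stp \<and>
    inp \<circ> tp' = inp \<circ> tp \<and> used (max R h) tp'"
proof -
  obtain q1 b d where \<delta>: "delta (M g) q (sim (tp h)) = (q1, b, d)" by (metis prod_cases3)
  have al: "q \<in> states (M g)" "sim (tp h) \<in> alphabet (M g)"
    using assms(2) by (auto simp: legal_def)
  then have b: "b = Marker \<longleftrightarrow> sim (tp h) = Marker"
    using pf[OF assms(1)] \<delta> unfolding pf_machine_def by blast
  have mk: "tp h = UMarker \<longleftrightarrow> h = 0" "sim (tp h) = Marker \<longleftrightarrow> h = 0"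
    using assms(2,4) by (cases "h \<le> R"; auto simp: legal_def used_def)+
  define z where "z = (if tp h = UMarker then tp h else UPair (inp (tp h)) b)"
  have "gstep \<delta> {Halt} (Sim g q, h, tp) = (Sim g q1, move_head d h, tp(h := z))"
    using al assms(3) \<delta> by (intro gstep_eq) (simp_all add: z_def)
  moreover have "q' = q1" "h' = move_head d h" "stp = (sim \<circ> tp)(h := b)"
    using assms(3,6) \<delta> by (auto simp: step.simps)
  moreover have "sim \<circ> tp(h := z) = (sim \<circ> tp)(h := b)"
    using b mk by (auto simp: fun_eq_iff z_def)
  moreover have "inp \<circ> tp(h := z) = inp \<circ> tp"
    by (auto simp: fun_eq_iff z_def)
  moreover have "used (max R h) (tp(h := z))"
    using assms(4,5) mk by (auto simp: used_def z_def le_Suc_eq)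
  ultimately show ?thesis by auto
qed

text \<open>
  Only the configurations before the first accepting one are simulated step by step, hence the
  least \<open>k\<close> below. The used part grows at most up to the head positions of the simulated run.
\<close>

lemma reach_simulate:
  assumes g: "g \<in> S" and w: "w \<in> lists \<Sigma>" and used: "used R tp" and inputs: "inputs v j tp"
    and stp: "sim \<circ> tp = initial_tape w"
  shows "\<exists>R' h tp'. R' \<le> max R (length w + c) \<and> h \<le> R' + 1 \<and> used R' tp' \<and> inputs v j tp' \<and>
     tape_output (sim \<circ> tp') (f g w) \<and>
     reach (C * length w + D + 1) (Sim g (start (M g)), 0, tp) (loop, h, tp')"
proof -
  define run where "run k = (step (M g) ^^ k) (initial_config (M g) w)" for k
  obtain k0 where k0: "k0 \<le> C * length w + D" "fst (run k0) \<in> accepting (M g)"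
      "tape_output (tape (run k0)) (f g w)"
    using computes[OF g w] by (auto simp: outputs_within_def run_def)
  define k where "k = (LEAST k. fst (run k) \<in> accepting (M g))"
  have acc: "fst (run k) \<in> accepting (M g)" unfolding k_def by (rule LeastI[of _ k0]) (rule k0(2))
  have "k \<le> k0" unfolding k_def by (rule Least_le) (rule k0(2))
  have running: "fst (run m) \<notin> accepting (M g)" if "m < k" for m
    using that not_less_Least unfolding k_def by blast
  have "run k0 = run k" using halted_later[of k "M g" "initial_config (M g) w" k0] acc \<open>k \<le> k0\<close>
    unfolding run_def by blast
  have legal: "legal (M g) (run m)" for m
    unfolding run_def by (intro legal_steps[OF pf[OF g]] legal_initial[OF pf[OF g] w])
  have "m \<le> k \<Longrightarrow> \<exists>R' tp'. R' \<le> max R (length w + c) \<and> head (run m) \<le> R' + 1 \<and> used R' tp' \<and>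
      inp \<circ> tp' = inp \<circ> tp \<and> sim \<circ> tp' = tape (run m) \<and>
      reach m (Sim g (start (M g)), 0, tp) (Sim g (fst (run m)), head (run m), tp')" for m
  proof (induction m)
    case 0
    show ?case
      using used stp by (intro exI[of _ R] exI[of _ tp]) (auto simp: run_def initial_config_def reach_refl)
  next
    case (Suc m)
    obtain q h t where r: "run m = (q, h, t)" by (metis prod_cases3)
    obtain q' h' t' where r': "run (Suc m) = (q', h', t')" by (metis prod_cases3)
    have "m \<le> k" using Suc.prems by simp
    from Suc.IH[OF this]
    obtain R' tp' where IH: "R' \<le> max R (length w + c)" "h \<le> R' + 1" "used R' tp'"
      "inp \<circ> tp' = inp \<circ> tp" "sim \<circ> tp' = t"
      "reach m (Sim g (start (M g)), 0, tp) (Sim g q, h, tp')"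
      unfolding r fst_conv snd_conv by blast
    have st: "step (M g) (q, h, sim \<circ> tp') = (q', h', t')"
      using r r' IH(5) by (simp add: run_def)
    have "legal (M g) (q, h, sim \<circ> tp')" "q \<notin> accepting (M g)"
      using legal[of m] running[of m] Suc.prems IH(5) by (auto simp: r)
    from sim_step[OF g this IH(3,2) st] obtain tp'' where
      tp'': "gstep \<delta> {Halt} (Sim g q, h, tp') = (Sim g q', h', tp'')" "sim \<circ> tp'' = t'"
        "inp \<circ> tp'' = inp \<circ> tp'" "used (max R' h) tp''" by blast
    have "h \<le> length w + c" using head_bound[OF g w, of m] r by (simp add: run_def)
    moreover have "h' \<le> h + 1" using head_step(1)[of "M g" "run m"] r r' by (simp add: run_def)
    ultimately show ?case
      using tp'' IH reach_trans[OF IH(6) reach_step[OF tp''(1)]]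
      by (intro exI[of _ "max R' h"] exI[of _ tp'']) (auto simp: r')
  qed
  from this[of k] obtain R' tp' where R': "R' \<le> max R (length w + c)" "head (run k) \<le> R' + 1" "used R' tp'"
      "inp \<circ> tp' = inp \<circ> tp" "sim \<circ> tp' = tape (run k)"
      "reach k (Sim g (start (M g)), 0, tp) (Sim g (fst (run k)), head (run k), tp')"
    by blast
  have "gstep \<delta> {Halt} (Sim g (fst (run k)), head (run k), tp') = (loop, head (run k), tp')"
    using acc by (subst gstep_eq[where d = Stay]) auto
  from reach_trans[OF R'(6) reach_step[OF this]]
  have "reach (C * length w + D + 1) (Sim g (start (M g)), 0, tp) (loop, head (run k), tp')"
    by (rule reach_mono) (use k0(1) \<open>k \<le> k0\<close> in simp)
  moreover have "inputs v j tp'"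
    using inputs R'(4) by (auto simp: inputs_def fun_eq_iff)
  moreover have "tape_output (sim \<circ> tp') (f g w)"
    using k0(3) R'(5) \<open>run k0 = run k\<close> by simp
  ultimately show ?thesis using R'(1-3) by blast
qed

lemma reach_finish:
  assumes "used R tp" and "sim \<circ> tp = initial_tape w"
  shows "\<exists>tp'. reach (length w + 2) (Fin, 0, tp) (Halt, length w + 1, tp') \<and> tp' 0 = UMarker \<and>
    (\<forall>i. 0 < i \<and> i \<le> length w \<longrightarrow> tp' i = UOut (w ! (i - 1))) \<and> tp' (length w + 1) = UBlank"
proof -
  define tp' where "tp' k i = (if 0 < i \<and> i \<le> k then UOut (w ! (i - 1)) else tp i)" for k i
  have s: "sim (tp i) = initial_tape w i" for i using assms(2) by (metis comp_apply)
  have z: "tp i \<noteq> UMarker" if "0 < i" for i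
    using that assms(1) by (cases "i \<le> R") (auto simp: used_def)
  have "k \<le> length w \<Longrightarrow> reach (k + 1) (Fin, 0, tp) (Fin, k + 1, tp' k)" for k
  proof (induction k)
    case 0
    have "gstep \<delta> {Halt} (Fin, 0, tp) = (Fin, 0 + 1, tp' 0)"
      using assms(1) by (subst gstep_eq[where d = MoveRight]) (auto simp: used_def tp'_def)
    from reach_step[OF this] show ?case by simp
  next
    case (Suc k)
    have "(tp' k)(k + 1 := UOut (w ! k)) = tp' (Suc k)" "tp' k (k + 1) = tp (k + 1)"
      by (auto simp: tp'_def fun_eq_iff le_Suc_eq)
    then have "gstep \<delta> {Halt} (Fin, k + 1, tp' k) = (Fin, Suc k + 1, tp' (Suc k))"
      using s[of "k + 1"] z[of "k + 1"] Suc.prems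
      by (subst gstep_eq[where d = MoveRight and z = "UOut (w ! k)"]) (auto simp: initial_tape_def)
    from reach_trans[OF Suc.IH reach_step[OF this]] Suc.prems show ?case by simp
  qed
  from this[of "length w"]
  have 1: "reach (length w + 1) (Fin, 0, tp) (Fin, length w + 1, tp' (length w))" by simp
  have "gstep \<delta> {Halt} (Fin, length w + 1, tp' (length w)) =
      (Halt, length w + 1, (tp' (length w))(length w + 1 := UBlank))"
    using s[of "length w + 1"] z[of "length w + 1"]
    by (subst gstep_eq[where d = Stay and z = UBlank]) (auto simp: initial_tape_def tp'_def)
  from reach_trans[OF 1 reach_step[OF this]] assms(1)
  show ?thesis
    by (intro exI[of _ "(tp' (length w))(length w + 1 := UBlank)"]) (auto simp: tp'_def used_def)
qed

lemma length_le_used: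
  assumes "used R tp" and "tape_output (sim \<circ> tp) w"
  shows "length w \<le> R"
proof (rule ccontr)
  assume "\<not> length w \<le> R"
  then have "tp (length w) = UBlank" "0 < length w" using assms(1) by (auto simp: used_def)
  then show False using assms(2) by (auto simp: tape_output_iff dest: spec[of _ "length w"])
qed

definition iterate :: "'g list \<Rightarrow> 's list" where
  "iterate v = foldl (\<lambda>w g. f g w) w0 v"

lemma iterate_in_lists: "v \<in> lists S \<Longrightarrow> iterate v \<in> lists \<Sigma>"
proof (induction v rule: rev_induct)
  case Nil
  then show ?case using w0 by (simp add: iterate_def)
next
  case (snoc g v)
  then show ?case using f[of g "iterate v"] by (simp add: iterate_def)
qed

text \<open>
  The used part covers \<open>w0\<close> and the input, and grows by at most \<open>c\<close> in each round, since the
  word on the work track is contained in it. A round takes time linear in its length.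
\<close>

definition region :: "nat \<Rightarrow> nat" where
  "region n = length w0 + n + n * c"

definition round_time :: "nat \<Rightarrow> nat" where
  "round_time n = (C + 3) * region n + D + 7"

definition total_time :: "nat \<Rightarrow> nat" where
  "total_time n = length w0 + 2 + n * round_time n + 4 * region n + 8"

lemma reach_rounds:
  assumes v: "v \<in> lists S" and "j \<le> length v"
  shows "\<exists>R h tp. R \<le> length w0 + length v + j * c \<and> h \<le> R + 1 \<and> used R tp \<and> inputs v j tp \<and>
    tape_output (sim \<circ> tp) (iterate (take j v)) \<and>
    reach (length w0 + 2 + j * round_time (length v)) (Init w0, 0, input_tape v) (loop, h, tp)"
  using assms(2)
proof (induction j)
  case 0
  obtain tp where tp: "used (max (length w0) (length v)) tp" "inputs v 0 tp" "tape_output (sim \<circ> tp) w0"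
     "reach (length w0 + 2) (Init w0, 0, input_tape v) (loop, length w0 + 1, tp)"
    using reach_init by blast
  show ?case
    by (rule exI[of _ "max (length w0) (length v)"], rule exI[of _ "length w0 + 1"], rule exI[of _ tp])
       (use tp in \<open>simp add: iterate_def comp_def\<close>)
next
  case (Suc j)
  let ?w = "iterate (take j v)" and ?g = "v ! j"
  have "j \<le> length v" using Suc.prems by simp
  from Suc.IH[OF this]
  obtain R h tp where IH: "R \<le> length w0 + length v + j * c" "h \<le> R + 1" "used R tp" "inputs v j tp"
    "tape_output (sim \<circ> tp) ?w"
    "reach (length w0 + 2 + j * round_time (length v)) (Init w0, 0, input_tape v) (loop, h, tp)"
    by blast
  have j: "j < length v" using Suc.prems by simp
  have g: "?g \<in> S" using v j by (auto simp: in_lists_conv_set)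
  have w: "?w \<in> lists \<Sigma>" using v by (intro iterate_in_lists) (auto dest: in_set_takeD)
  have len: "length ?w \<le> R" by (rule length_le_used[OF IH(3,5)])
  have R: "R \<le> region (length v)"
  proof -
    have "j * c \<le> length v * c" using j by (intro mult_right_mono) auto
    then show ?thesis using IH(1) unfolding region_def by linarith
  qed
  obtain tp1 where 1: "used R tp1" "inputs v (Suc j) tp1" "sim \<circ> tp1 = initial_tape ?w"
    "reach (R + 2) (Sweep False None, 0, tp) (Rew (Sim ?g (start (M ?g))), R + 1, tp1)"
    using reach_sweep[OF IH(3-5)] j by auto
  obtain R' h' tp2 where 2: "R' \<le> max R (length ?w + c)" "h' \<le> R' + 1" "used R' tp2" "inputs v (Suc j) tp2"
     "tape_output (sim \<circ> tp2) (f ?g ?w)"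
     "reach (C * length ?w + D + 1) (Sim ?g (start (M ?g)), 0, tp1) (loop, h', tp2)"
    using reach_simulate[OF g w 1(1-3)] by blast
  have "reach ((h + 1) + (R + 2) + (R + 1 + 1) + (C * length ?w + D + 1)) (loop, h, tp) (loop, h', tp2)"
    by (intro reach_trans[OF _ 2(6)] reach_trans[OF _ reach_rewind[OF 1(1)]] reach_trans[OF _ 1(4)]
        reach_rewind[OF IH(3)])
  moreover have "C * length ?w \<le> C * region (length v)" using len R by (intro mult_left_mono) auto
  then have "(h + 1) + (R + 2) + (R + 1 + 1) + (C * length ?w + D + 1) \<le> round_time (length v)"
    using R IH(2) unfolding round_time_def distrib_right by linarith
  ultimately have "reach (round_time (length v)) (loop, h, tp) (loop, h', tp2)" by (rule reach_mono)
  from reach_trans[OF IH(6) this]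
  have "reach (length w0 + 2 + Suc j * round_time (length v)) (Init w0, 0, input_tape v) (loop, h', tp2)"
    by (simp add: algebra_simps)
  moreover have "iterate (take (Suc j) v) = f ?g ?w"
    using j by (simp add: iterate_def take_Suc_conv_app_nth)
  moreover have "R' \<le> length w0 + length v + Suc j * c"
    using 2(1) len IH(1) by auto
  ultimately show ?case using 2(2-5) by metis
qed

lemma reach_halt:
  assumes v: "v \<in> lists S"
  shows "\<exists>h tp. reach (total_time (length v)) (Init w0, 0, input_tape v) (Halt, h, tp) \<and> tp 0 = UMarker \<and>
    (\<forall>i. 0 < i \<and> i \<le> length (iterate v) \<longrightarrow> tp i = UOut (iterate v ! (i - 1))) \<and>
    tp (length (iterate v) + 1) = UBlank"
proof -
  let ?n = "length v"
  obtain R h tp where "R \<le> length w0 + ?n + ?n * c" and IH: "h \<le> R + 1" "used R tp" "inputs v ?n tp"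
    "tape_output (sim \<circ> tp) (iterate (take ?n v))"
    "reach (length w0 + 2 + ?n * round_time ?n) (Init w0, 0, input_tape v) (loop, h, tp)"
    using reach_rounds[OF v order_refl] by blast
  then have R: "R \<le> region ?n" and out: "tape_output (sim \<circ> tp) (iterate v)"
    by (simp_all add: region_def)
  obtain tp1 where 1: "used R tp1" "sim \<circ> tp1 = initial_tape (iterate v)"
    "reach (R + 2) (Sweep False None, 0, tp) (Rew Fin, R + 1, tp1)"
    using reach_sweep[OF IH(2,3) out] by auto
  obtain tp2 where 2: "reach (length (iterate v) + 2) (Fin, 0, tp1) (Halt, length (iterate v) + 1, tp2)"
    "tp2 0 = UMarker" "\<forall>i. 0 < i \<and> i \<le> length (iterate v) \<longrightarrow> tp2 i = UOut (iterate v ! (i - 1))"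
    "tp2 (length (iterate v) + 1) = UBlank"
    using reach_finish[OF 1(1,2)] by blast
  have "reach ((length w0 + 2 + ?n * round_time ?n) + (h + 1) + (R + 2) + (R + 1 + 1) + (length (iterate v) + 2))
      (Init w0, 0, input_tape v) (Halt, length (iterate v) + 1, tp2)"
    by (intro reach_trans[OF _ 2(1)] reach_trans[OF _ reach_rewind[OF 1(1)]] reach_trans[OF _ 1(3)]
        reach_trans[OF _ reach_rewind[OF IH(2)]] IH(5))
  moreover have "(length w0 + 2 + ?n * round_time ?n) + (h + 1) + (R + 2) + (R + 1 + 1) + (length (iterate v) + 2)
      \<le> total_time ?n"
    using R IH(1) length_le_used[OF IH(2) out] by (simp add: total_time_def)
  ultimately have "reach (total_time ?n) (Init w0, 0, input_tape v) (Halt, length (iterate v) + 1, tp2)"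
    by (rule reach_mono)
  then show ?thesis using 2 by blast
qed

end

context iteration
begin

section \<open>Alphabet, states and running time\<close>

definition letters :: "'s cell set" where
  "letters = insert Blank (Letter ` \<Sigma> \<union> (\<Union>g\<in>S. alphabet (M g))) - {Marker}"

definition symbols :: "('g, 's) sym set" where
  "symbols = {UMarker, UBlank} \<union> UIn ` S \<union> UOut ` {a. Letter a \<in> letters} \<union>
     case_prod UPair ` (insert None (Some ` S) \<times> letters)"

text \<open>
  The states to which a rewind may return. Keeping them apart from the rewinding states makes
  the state set finite although \<open>Rew\<close> is recursive.
\<close>

definition phases :: "('g, 's) ctl set" where
  "phases = Init ` {ws. set ws \<subseteq> \<Sigma> \<and> length ws \<le> length w0} \<union>
     case_prod Sweep ` (UNIV \<times> insert None (Some ` S)) \<union> (\<Union>g\<in>S. Sim g ` states (M g)) \<union> {Fin, Halt}"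

definition controls :: "('g, 's) ctl set" where
  "controls = phases \<union> Rew ` phases"

lemma finite_letters: "finite letters"
  using finite_S finite_\<Sigma> pf by (auto simp: letters_def pf_machine_def)

lemma finite_symbols: "finite symbols"
proof -
  have "finite {a. Letter a \<in> letters}"
    using finite_vimageI[OF finite_letters, of Letter] by (simp add: vimage_def inj_def)
  then show ?thesis
    unfolding symbols_def using finite_S finite_letters by auto
qed

lemma finite_controls: "finite controls"
proof -
  have "finite phases"
    unfolding phases_def using finite_S finite_\<Sigma> pf
    by (auto simp: pf_machine_def intro!: finite_lists_length_le)
  then show ?thesis by (simp add: controls_def)
qed

lemma phase_intros:
  "set ws \<subseteq> \<Sigma> \<Longrightarrow> length ws \<le> length w0 \<Longrightarrow> Init ws \<in> phases"
  "i \<in> insert None (Some ` S) \<Longrightarrow> Sweep e i \<in> phases"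
  "g \<in> S \<Longrightarrow> q \<in> states (M g) \<Longrightarrow> Sim g q \<in> phases"
  "Fin \<in> phases" "Halt \<in> phases"
  by (auto simp: phases_def)

lemma symbol_intros:
  "UMarker \<in> symbols" "UBlank \<in> symbols"
  "Letter a \<in> letters \<Longrightarrow> UOut a \<in> symbols"
  "i \<in> insert None (Some ` S) \<Longrightarrow> b \<in> letters \<Longrightarrow> UPair i b \<in> symbols"
  by (auto simp: symbols_def)

lemma symbol_tracks:
  assumes "z \<in> symbols"
  shows "inp z \<in> insert None (Some ` S)" and "sim z = Marker \<longleftrightarrow> z = UMarker"
    and "z \<noteq> UMarker \<Longrightarrow> sim z \<in> letters"
  using assms by (auto simp: symbols_def letters_def)

lemma \<delta>_closed:
  assumes q: "q \<in> controls" and z: "z \<in> symbols" and "\<delta> q z = (q', z', d)"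
  shows "q' \<in> controls \<and> z' \<in> symbols \<and> (z' = UMarker \<longleftrightarrow> z = UMarker) \<and> (z = UMarker \<longrightarrow> d \<noteq> MoveLeft)"
proof -
  note tracks = symbol_tracks[OF z]
  have blank: "Blank \<in> letters" by (simp add: letters_def)
  show ?thesis
  proof (cases q)
    case (Init ws)
    then have ws: "set ws \<subseteq> \<Sigma>" "length ws \<le> length w0" using q by (auto simp: controls_def phases_def)
    have loop: "Sweep False None \<in> phases" by (rule phase_intros) simp
    show ?thesis
    proof (cases ws)
      case Nil
      then show ?thesis using assms Init loop by (auto simp: controls_def split: if_splits)
    next
      case (Cons a as)
      then have "Letter a \<in> letters" using ws by (auto simp: letters_def)
      then show ?thesis
        using assms Init Cons ws tracks by (auto simp: controls_def intro!: phase_intros symbol_intros split: if_splits)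
    qed
  next
    case (Rew t)
    then have "t \<in> phases" using q by (auto simp: controls_def phases_def)
    then show ?thesis using assms Rew by (auto simp: controls_def split: if_splits)
  next
    case (Sweep e i)
    then have i: "i \<in> insert None (Some ` S)" using q by (auto simp: controls_def phases_def)
    have "(case i of None \<Rightarrow> Fin | Some s \<Rightarrow> Sim s (start (M s))) \<in> phases"
      using i pf by (auto simp: pf_machine_def intro!: phase_intros)
    moreover have "Sweep e' (if i = None then inp z else i) \<in> phases" for e'
      using i tracks(1) by (intro phase_intros) auto
    moreover have "UPair (if i = None then None else inp z) (if e then Blank else sim z) \<in> symbols"
      if "z \<noteq> UMarker"
      using tracks that blank by (intro symbol_intros) auto
    ultimately show ?thesis
      using assms Sweep i by (auto simp: controls_def simp del: if_split split: if_split_asm)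
  next
    case (Sim g q1)
    then have g: "g \<in> S" "q1 \<in> states (M g)" using q by (auto simp: controls_def phases_def)
    obtain q2 b d2 where \<delta>: "delta (M g) q1 (sim z) = (q2, b, d2)" by (metis prod_cases3)
    have loop: "Sweep False None \<in> phases" by (rule phase_intros) simp
    have "q2 \<in> states (M g) \<and> b \<in> alphabet (M g) \<and> (b = Marker \<longleftrightarrow> sim z = Marker) \<and>
       (sim z = Marker \<longrightarrow> d2 \<noteq> MoveLeft)" if "sim z \<in> alphabet (M g)"
      using pf[OF g(1)] g(2) that \<delta> unfolding pf_machine_def by blast
    moreover have "b \<in> letters" if "b \<in> alphabet (M g)" "b \<noteq> Marker"
      using that g by (auto simp: letters_def)
    ultimately show ?thesis
      using assms Sim loop g \<delta> tracks
      by (auto simp: controls_def intro!: phase_intros symbol_intros split: if_splits)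
  next
    case Fin
    have "Letter a \<in> letters" if "sim z = Letter a" for a
      using tracks that by (cases "z = UMarker") auto
    then show ?thesis
      using assms Fin by (auto simp: controls_def intro!: phase_intros symbol_intros split: if_splits cell.splits)
  next
    case Halt
    then show ?thesis using assms q by auto
  qed
qed

lemma region_bound: "0 < n \<Longrightarrow> region n \<le> (length w0 + 1 + c) * n"
  by (simp add: region_def algebra_simps)

lemma total_time_quadratic: "(\<lambda>n. real (total_time n)) \<in> O(\<lambda>n. real n ^ 2)"
proof -
  define a where "a = length w0 + 1 + c"
  define K where "K = (C + 3) * a + D + 7 + 4 * a + length w0 + 10"
  have bound: "total_time n \<le> K * n ^ 2" if "0 < n" for n
  proof -
    have r: "region n \<le> a * n" using region_bound[OF that] by (simp add: a_def)
    have n: "n \<le> n ^ 2" "1 \<le> n ^ 2" using that by (auto simp: power2_eq_square)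
    have "round_time n \<le> ((C + 3) * a + D + 7) * n"
    proof -
      have "(C + 3) * region n \<le> (C + 3) * (a * n)" using r by (rule mult_left_mono) simp
      moreover have "D + 7 \<le> (D + 7) * n" using that by simp
      ultimately have "round_time n \<le> (C + 3) * (a * n) + (D + 7) * n" unfolding round_time_def by linarith
      then show ?thesis by (simp add: algebra_simps)
    qed
    then have "n * round_time n \<le> n * (((C + 3) * a + D + 7) * n)" by (rule mult_left_mono) simp
    moreover have "4 * region n \<le> 4 * a * n ^ 2"
    proof -
      have "4 * region n \<le> 4 * a * n" using r by simp
      also have "\<dots> \<le> 4 * a * n ^ 2" using n(1) by (rule mult_left_mono) simp
      finally show ?thesis .
    qed
    moreover have "length w0 + 10 \<le> (length w0 + 10) * n ^ 2" using n(2) by simp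
    ultimately have "total_time n \<le> n * (((C + 3) * a + D + 7) * n) + 4 * a * n ^ 2 + (length w0 + 10) * n ^ 2"
      unfolding total_time_def by linarith
    also have "\<dots> = K * n ^ 2" by (simp add: K_def power2_eq_square algebra_simps)
    finally show ?thesis .
  qed
  have real_bound: "real (total_time n) \<le> real K * real n ^ 2" if "0 < n" for n
    using bound[OF that] by (metis of_nat_le_iff of_nat_mult of_nat_power)
  have "real (total_time n) \<le> (real K + 1) * real n ^ 2" if "0 < n" for n
    using real_bound[OF that] by (rule order_trans) (simp add: distrib_right)
  then have "\<forall>n\<ge>1. norm (real (total_time n)) \<le> (real K + 1) * norm (real n ^ 2)" by simp
  then show ?thesis
    by (intro landau_o.bigI[where c = "real K + 1"]) (auto simp: eventually_sequentially)
qed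

theorem iterate_computable:
  "pf_computable_in (Inl :: 'g \<Rightarrow> 'g + 's) S Inr \<Sigma> iterate (\<lambda>n. real n ^ 2)"
proof -
  obtain en :: "'g option \<times> 's cell \<Rightarrow> nat" where en: "inj_on en (insert None (Some ` S) \<times> letters)"
    using finite_imp_inj_to_nat_seg[of "insert None (Some ` S) \<times> letters"] finite_S finite_letters
    by auto
  define \<iota> :: "('g, 's) sym \<Rightarrow> ('g + 's) cell" where
    "\<iota> z = (case z of UMarker \<Rightarrow> Marker | UBlank \<Rightarrow> Blank | UIn g \<Rightarrow> Letter (Inl g)
       | UOut a \<Rightarrow> Letter (Inr a) | UPair i b \<Rightarrow> Work (en (i, b)))" for z
  have \<iota>_Marker: "\<iota> z = Marker \<longleftrightarrow> z = UMarker" for z by (simp add: \<iota>_def split: sym.splits)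
  have pair: "(i, b) \<in> insert None (Some ` S) \<times> letters" if "UPair i b \<in> symbols" for i b
    using that by (auto simp: symbols_def)
  have pair_inj: "i = i' \<and> b = b'"
    if "UPair i b \<in> symbols" "UPair i' b' \<in> symbols" "en (i, b) = en (i', b')" for i b i' b'
    using inj_onD[OF en that(3) pair[OF that(1)] pair[OF that(2)]] by simp
  have inj: "inj_on \<iota> symbols"
  proof (rule inj_onI)
    fix y z assume yz: "y \<in> symbols" "z \<in> symbols" "\<iota> y = \<iota> z"
    show "y = z"
      using yz(3) pair_inj yz(1,2) unfolding \<iota>_def by (auto split: sym.split_asm)
  qed
  have alph: "insert Marker (insert Blank (Letter ` Inl ` S)) \<subseteq> \<iota> ` symbols"
  proof -
    have "\<iota> ` {UMarker, UBlank} \<union> \<iota> ` UIn ` S = insert Marker (insert Blank (Letter ` Inl ` S))"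
      by (simp add: \<iota>_def image_image)
    moreover have "{UMarker, UBlank} \<union> UIn ` S \<subseteq> symbols" unfolding symbols_def by blast
    ultimately show ?thesis by blast
  qed
  have start: "Init w0 \<in> controls" and halt: "{Halt} \<subseteq> controls"
    using w0 by (auto simp: controls_def intro!: phase_intros dest: in_listsD)
  have closed: "q' \<in> controls \<and> z' \<in> symbols \<and> (\<iota> z' = Marker \<longleftrightarrow> \<iota> z = Marker) \<and>
      (\<iota> z = Marker \<longrightarrow> d \<noteq> MoveLeft)"
    if "q \<in> controls" "z \<in> symbols" "\<delta> q z = (q', z', d)" for q z q' z' d
    using \<delta>_closed[OF that] unfolding \<iota>_Marker .
  obtain U where U: "pf_machine (Inl ` S) U" and run: "\<And>k h tp q' h' tp'. range tp \<subseteq> symbols \<Longrightarrow>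
      (gstep \<delta> {Halt} ^^ k) (Init w0, h, tp) = (q', h', tp') \<Longrightarrow> q' \<in> {Halt} \<Longrightarrow>
      \<exists>e. (step U ^^ k) (start U, h, \<iota> \<circ> tp) = (e, h', \<iota> \<circ> tp') \<and> e \<in> accepting U"
    by (rule realize_machine[OF finite_controls finite_symbols start halt inj alph, of \<delta>])
       (erule (2) closed, blast)
  have "outputs_within U (map Inl v) (map Inr (iterate v)) (total_time (length v))"
    if v: "v \<in> lists S" for v
  proof -
    obtain h tp where halt: "reach (total_time (length v)) (Init w0, 0, input_tape v) (Halt, h, tp)"
      "tp 0 = UMarker" "\<forall>i. 0 < i \<and> i \<le> length (iterate v) \<longrightarrow> tp i = UOut (iterate v ! (i - 1))"
      "tp (length (iterate v) + 1) = UBlank"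
      using reach_halt[OF v] by blast
    then obtain k where k: "k \<le> total_time (length v)"
        "(gstep \<delta> {Halt} ^^ k) (Init w0, 0, input_tape v) = (Halt, h, tp)"
      unfolding reach_def by blast
    have "range (input_tape v) \<subseteq> symbols"
      using v by (auto simp: input_tape_def symbols_def in_lists_conv_set)
    from run[OF this k(2)] obtain e where
      e: "(step U ^^ k) (start U, 0, \<iota> \<circ> input_tape v) = (e, h, \<iota> \<circ> tp)" "e \<in> accepting U" by auto
    have "initial_config U (map Inl v) = (start U, 0, \<iota> \<circ> input_tape v)"
      by (auto simp: initial_config_def initial_tape_def input_tape_def \<iota>_def fun_eq_iff)
    moreover have "tape_output (\<iota> \<circ> tp) (map Inr (iterate v))"
      using halt(2-4) by (auto simp: tape_output_iff \<iota>_def)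
    ultimately show ?thesis
      using e k(1) unfolding outputs_within_def by auto
  qed
  then show ?thesis
    unfolding pf_computable_in_def using iterate_in_lists U total_time_quadratic by blast
qed

end

section \<open>Evaluating words in the group\<close>

lemma pf_linear_computable_bounds:
  assumes "pf_linear_computable \<Sigma> f"
  obtains M C D c where "pf_machine \<Sigma> M"
    and "\<And>w. w \<in> lists \<Sigma> \<Longrightarrow> outputs_within M w (f w) (C * length w + D)"
    and "\<And>w t. w \<in> lists \<Sigma> \<Longrightarrow> head ((step M ^^ t) (initial_config M w)) \<le> length w + c"
proof -
  obtain M T where M: "pf_machine \<Sigma> M" and T: "(\<lambda>n. real (T n)) \<in> O(\<lambda>n. real n)"
    and out: "\<And>w. w \<in> lists \<Sigma> \<Longrightarrow> outputs_within M w (f w) (T (length w))"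
    using assms by (auto simp: pf_linear_computable_def pf_computable_in_def)
  obtain C n0 where C: "\<And>n. n0 \<le> n \<Longrightarrow> T n \<le> C * n" using linear_bound[OF T] by blast
  define D where "D = (\<Sum>n\<le>n0. T n)"
  have time: "T n \<le> C * n + D" for n
  proof (cases "n \<le> n0")
    case True
    then have "T n \<le> D" unfolding D_def by (intro member_le_sum) auto
    then show ?thesis by simp
  next
    case False
    then show ?thesis using C[of n] by simp
  qed
  have halts: "\<exists>k\<le>T (length w). fst ((step M ^^ k) (initial_config M w)) \<in> accepting M"
    if "w \<in> lists \<Sigma>" for w
    using out[OF that] unfolding outputs_within_def by (metis fst_conv)
  obtain c where "\<And>w t. w \<in> lists \<Sigma> \<Longrightarrow> head ((step M ^^ t) (initial_config M w)) \<le> length w + c"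
    using linear_time_head_bound[OF M T halts] by blast
  moreover have "outputs_within M w (f w) (C * length w + D)" if "w \<in> lists \<Sigma>" for w
    using out[OF that] time[of "length w"] unfolding outputs_within_def by (meson order_trans)
  ultimately show ?thesis using that[of M C D c] M by blast
qed

text \<open>
Finitely many machines have common bounds, for instance the sums of their constants.
\<close>

lemma iteration_exists:
  assumes "finite S" and "finite \<Sigma>" and "w0 \<in> lists \<Sigma>"
    and f: "\<And>s. s \<in> S \<Longrightarrow> pf_linear_computable \<Sigma> (f s)"
  shows "\<exists>M C D c. iteration S \<Sigma> M f w0 C D c"
proof -
  have "\<forall>s\<in>S. \<exists>x. case x of (M, C, D, c) \<Rightarrow> pf_machine \<Sigma> M
    \<and> (\<forall>w\<in>lists \<Sigma>. outputs_within M w (f s w) (C * length w + D))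
    \<and> (\<forall>w\<in>lists \<Sigma>. \<forall>t. head ((step M ^^ t) (initial_config M w)) \<le> length w + c)"
  proof
    fix s assume "s \<in> S"
    from pf_linear_computable_bounds[OF f[OF this]]
    obtain M C D c where "pf_machine \<Sigma> M"
      "\<And>w. w \<in> lists \<Sigma> \<Longrightarrow> outputs_within M w (f s w) (C * length w + D)"
      "\<And>w t. w \<in> lists \<Sigma> \<Longrightarrow> head ((step M ^^ t) (initial_config M w)) \<le> length w + c" by blast
    then show "\<exists>x. case x of (M, C, D, c) \<Rightarrow> pf_machine \<Sigma> M
      \<and> (\<forall>w\<in>lists \<Sigma>. outputs_within M w (f s w) (C * length w + D))
      \<and> (\<forall>w\<in>lists \<Sigma>. \<forall>t. head ((step M ^^ t) (initial_config M w)) \<le> length w + c)"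
      by (intro exI[of _ "(M, C, D, c)"]) simp
  qed
  then obtain F where F: "\<forall>s\<in>S. case F s of (M, C, D, c) \<Rightarrow> pf_machine \<Sigma> M
    \<and> (\<forall>w\<in>lists \<Sigma>. outputs_within M w (f s w) (C * length w + D))
    \<and> (\<forall>w\<in>lists \<Sigma>. \<forall>t. head ((step M ^^ t) (initial_config M w)) \<le> length w + c)"
    by (rule bchoice[THEN exE])
  define M C D c where "M s = fst (F s)" and "C s = fst (snd (F s))"
    and "D s = fst (snd (snd (F s)))" and "c s = snd (snd (snd (F s)))" for s
  have F': "pf_machine \<Sigma> (M s)"
    "w \<in> lists \<Sigma> \<Longrightarrow> outputs_within (M s) w (f s w) (C s * length w + D s)"
    "w \<in> lists \<Sigma> \<Longrightarrow> head ((step (M s) ^^ t) (initial_config (M s) w)) \<le> length w + c s"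
    if "s \<in> S" for s w t
    using F[rule_format, OF that] unfolding M_def C_def D_def c_def by (simp_all add: case_prod_beta)
  have le: "g s \<le> sum g S" if "s \<in> S" for s and g :: "'a \<Rightarrow> nat"
    using that assms(1) by (intro member_le_sum) auto
  have "iteration S \<Sigma> M f w0 (sum C S) (sum D S) (sum c S)"
  proof
    fix s w t assume s: "s \<in> S" and w: "w \<in> lists \<Sigma>"
    show "f s w \<in> lists \<Sigma>"
      using f[OF s] w by (auto simp: pf_linear_computable_def pf_computable_in_def)
    have "C s * length w + D s \<le> sum C S * length w + sum D S"
      using le[OF s] by (intro add_mono mult_right_mono) auto
    then show "outputs_within (M s) w (f s w) (sum C S * length w + sum D S)"
      using F'(2)[OF s w] unfolding outputs_within_def by (meson order_trans)
    show "head ((step (M s) ^^ t) (initial_config (M s) w)) \<le> length w + sum c S"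
      using F'(3)[OF s w, of t] le[OF s, of c] by linarith
  qed (use assms F' in blast)+
  then show ?thesis by blast
qed

lemma (in monoid) word_prod_closed: "set v \<subseteq> carrier G \<Longrightarrow> word_prod G v \<in> carrier G"
  by (induction v) (auto simp: word_prod_def)

lemma (in monoid) word_prod_snoc:
  "set v \<subseteq> carrier G \<Longrightarrow> s \<in> carrier G \<Longrightarrow> word_prod G (v @ [s]) = word_prod G v \<otimes> s"
proof (induction v)
  case (Cons a v)
  then show ?case
    using word_prod_closed[of v] by (simp add: word_prod_def m_assoc)
qed (simp add: word_prod_def)

theorem theorem2:
  fixes G :: "('g, 'm) monoid_scheme"
    and A :: "'g set"
    and \<Sigma> :: "'s set"
    and L :: "'s list set"
    and \<psi> :: "'s list \<Rightarrow> 'g"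
  assumes "group G"
    and "finite A" and "A \<subseteq> carrier G" and "generate G A = carrier G"
    and "cayley_pf_linear_rep G (A \<union> m_inv G ` A) \<Sigma> L \<psi>"
  shows "\<exists>u :: 'g list \<Rightarrow> 's list.
    (\<forall>v\<in>lists (A \<union> m_inv G ` A). u v \<in> L \<and> \<psi> (u v) = word_prod G v) \<and>
    pf_computable_in (Inl :: 'g \<Rightarrow> 'g + 's) (A \<union> m_inv G ` A) Inr \<Sigma> u (\<lambda>n. real n ^ 2)"
proof -
  interpret group G by fact
  define S where "S = A \<union> m_inv G ` A"
  have S: "finite S" "S \<subseteq> carrier G" and \<Sigma>: "finite \<Sigma>" and L: "L \<subseteq> lists \<Sigma>"
    and \<psi>: "bij_betw \<psi> L (carrier G)"
    and "\<exists>f. \<forall>s\<in>S. pf_linear_computable \<Sigma> (f s) \<and> f s ` L \<subseteq> L \<and>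
        (\<forall>w\<in>L. \<psi> (f s w) = \<psi> w \<otimes>\<^bsub>G\<^esub> s)"
    using assms(5) unfolding cayley_pf_linear_rep_def semigroup_generators_def S_def[symmetric]
    by simp_all
  then obtain f where rep: "\<forall>s\<in>S. pf_linear_computable \<Sigma> (f s) \<and> f s ` L \<subseteq> L \<and>
        (\<forall>w\<in>L. \<psi> (f s w) = \<psi> w \<otimes>\<^bsub>G\<^esub> s)" by (elim exE)
  have "\<one>\<^bsub>G\<^esub> \<in> \<psi> ` L" using \<psi> by (simp add: bij_betw_def)
  then obtain w0 where one: "w0 \<in> L" "\<psi> w0 = \<one>\<^bsub>G\<^esub>" by auto
  have "w0 \<in> lists \<Sigma>" using one L by blast
  from iteration_exists[of S \<Sigma> w0 f, OF S(1) \<Sigma> this] rep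
  obtain M C D c where "iteration S \<Sigma> M f w0 C D c" by blast
  then interpret iteration S \<Sigma> M f w0 C D c .
  have "iterate v \<in> L \<and> \<psi> (iterate v) = word_prod G v" if "v \<in> lists S" for v
    using that
  proof (induction v rule: rev_induct)
    case Nil
    then show ?case using one by (simp add: iterate_def word_prod_def)
  next
    case (snoc s v)
    then have s: "s \<in> S" and v: "set v \<subseteq> carrier G" and IH: "iterate v \<in> L" "\<psi> (iterate v) = word_prod G v"
      using S(2) by auto
    have "iterate (v @ [s]) = f s (iterate v)" by (simp add: iterate_def)
    then show ?case
      using rep s IH word_prod_snoc[OF v, of s] S(2) by auto
  qed
  then show ?thesis
    using iterate_computable unfolding S_def by blast
qed

end
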